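(* Let $(X,\mu,T)$ be a rank-one measure-preserving transformation, with towers of bases $B_n$ and heights $h_n$, and let $I_{m,n}=\{i : 0\le i<h_n,\ T^i(B_n)\subseteq B_m\}$ for $n\ge m$. Let $\mathcal{O}_K$ be an odometer, where $K$ is its (infinite) set of finite factors. The following are equivalent. (i) $(X,\mu,T)$ factors onto $\mathcal{O}_K$. (ii) For every $k\in K$ and every real $\eta>0$ there exists $N\in\mathbb{N}$ such that for all $n\ge m\ge N$ there exists $j\in\mathbb{Z}/k\mathbb{Z}=\{0,1,\dots,k-1\}$ with $$\frac{|\{i\in I_{m,n} : [i]_k\neq j\}|}{|I_{m,n}|}<\eta .$$
   Context: $\mathbb{N}=\{0,1,2,\dots\}$. For a positive integer $k$ and $n\in\mathbb{N}$, $[n]_k$ denotes the unique $m\in\{0,\dots,k-1\}$ with $n\equiv m \pmod k$; $\mathbb{Z}/k\mathbb{Z}$ is identified with $\{0,\dots,k-1\}$. Measure-preserving transformations. $(X,\mu)$ is a nonatomic standard Lebesgue probability space. A map $\phi:(X,\mu)\to(Y,\nu)$ is measure-preserving if for all measurable $A\subseteq Y$, $\phi^{-1}(A)$ is measurable and $\mu(\phi^{-1}(A))=\nu(A)$. A (measure-preserving) transformation $T:(X,\mu)\to(X,\mu)$ is a measure-preserving map that is invertible on a set of full measure and whose inverse is measure-preserving. A factor map from $(X,\mu,T)$ to $(Y,\nu,S)$ is a measure-preserving map $\phi:(X,\mu)\to(Y,\nu)$ (defined on a set of full measure) with $\phi(T(x))=S(\phi(x))$ for $\mu$-almost every $x$;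 $T$ factors onto $S$ if such a map exists. Odometers. Let $(k_n:n\in\mathbb{N})$ be an unbounded sequence of integers greater than $1$ with $k_n\mid k_{n+1}$ for all $n$. The corresponding odometer is the transformation $\alpha\mapsto([\alpha_n+1]_{k_n})_{n\in\mathbb{N}}$ on the set of all sequences $\alpha=(\alpha_n)_{n\in\mathbb{N}}\in\prod_n\mathbb{Z}/k_n\mathbb{Z}$ satisfying $[\alpha_n]_{k_m}=\alpha_m$ for all $m\le n$, equipped with the probability measure for which $\{\alpha:\alpha_n=i\}$ has measure $1/k_n$ for all $n$ and all $0\le i<k_n$. Put $K=\bigcup_{n}\{m\ge1 : m\mid k_n\}$, an infinite set of positive integers closed under taking factors. Up to isomorphism the odometer depends only on $K$, and is denoted $\mathcal{O}_K$. Rank-one transformations. A measure-preserving transformation $T$ on a nonatomic standard Lebesgue probability space $(X,\mu)$ is rank-one if there exist integers $r_n>1$ ($n\in\mathbb{N}$) and nonnegative integers $s_{n,i}$ ($n\in\mathbb{N}$, $0<i\le r_n$) such that, with $h_0=1$ and $h_{n+1}=r_nh_n+\sum_{0<i\le r_n}s_{n,i}$, we have $\sum_{n=0}^\infty \frac{h_{n+1}-r_nh_n}{h_{n+1}}<\infty$, and there are measurable subsets $B_n$, $B_{n,i}$ ($0<i\le r_n$), and $C_{n,i,j}$ ($0<i\le r_n$, $0<j\le s_{n,i}$) of $X$ such that for all $n$: - $\{B_{n,i}:0<i\le r_n\}$ is a partition of $B_n$; - the sets $T^k(B_n)$, $0\le k<h_n$, are disjoint; - $T^{h_n}(B_{n,i})=C_{n,i,1}$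 if $s_{n,i}\ne0$ and $i\le r_n$; - $T^{h_n}(B_{n,i})=B_{n,i+1}$ if $s_{n,i}=0$ and $i<r_n$; - $T(C_{n,i,j})=C_{n,i,j+1}$ if $j<s_{n,i}$; - $T(C_{n,i,s_{n,i}})=B_{n,i+1}$ if $i<r_n$ (and $s_{n,i}\neq 0$); - $B_{n+1}=B_{n,1}$; and the collection $\bigcup_{n}\{B_n,T(B_n),\dots,T^{h_n-1}(B_n)\}$ is dense in the $\sigma$-algebra of $\mu$-measurable sets, i.e. every measurable set can be approximated arbitrarily well in measure (of the symmetric difference) by finite unions of these sets. When a rank-one transformation is given, such data are fixed. The collection $\{B_n,\dots,T^{h_n-1}(B_n)\}$ is the stage-$n$ tower, with base $B_n$, height $h_n$, and levels $T^k(B_n)$. For $n\ge m$, $B_m$ is the disjoint union of the levels $T^i(B_n)$, $i\in I_{m,n}$; the finite sets $I_{m,n}$ are determined by the cutting parameter $(r_n)$ and the spacer parameter $(s_{n,i})$. *)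

theory Defs
  imports "HOL-Probability.Probability"
begin

section \<open>Measure-preserving maps and transformations\<close>

definition measure_preserving_map :: "'a measure \<Rightarrow> 'b measure \<Rightarrow> ('a \<Rightarrow> 'b) \<Rightarrow> bool" where
  "measure_preserving_map M N f \<longleftrightarrow>
     f \<in> M \<rightarrow>\<^sub>M N \<and> (\<forall>A\<in>sets N. emeasure M (f -` A \<inter> space M) = emeasure N A)"

definition full_measure_set :: "'a measure \<Rightarrow> 'a set \<Rightarrow> bool" where
  "full_measure_set M A \<longleftrightarrow> A \<in> sets M \<and> emeasure M (space M - A) = 0"

text \<open>The inverse is only defined on the image \<open>f ` A\<close> of the set of full measure on which
  \<open>f\<close> is injective; hence the restriction of \<open>N\<close> to that image.\<close>

definition mp_isomorphism :: "'a measure \<Rightarrow> 'b measure \<Rightarrow> ('a \<Rightarrow> 'b) \<Rightarrow> bool" where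
  "mp_isomorphism M N f \<longleftrightarrow>
     measure_preserving_map M N f \<and>
     (\<exists>A. full_measure_set M A \<and> inj_on f A \<and> full_measure_set N (f ` A) \<and>
        measure_preserving_map (restrict_space N (f ` A)) M (the_inv_into A f))"

definition mp_transformation :: "'a measure \<Rightarrow> ('a \<Rightarrow> 'a) \<Rightarrow> bool" where
  "mp_transformation M T \<longleftrightarrow> mp_isomorphism M M T"

definition nonatomic_standard_Lebesgue_space :: "'a measure \<Rightarrow> bool" where
  "nonatomic_standard_Lebesgue_space M \<longleftrightarrow>
     prob_space M \<and> complete_measure M \<and>
     (\<exists>f. mp_isomorphism M (restrict_space lebesgue {0..1::real}) f)"

text \<open>A factor map only has to be defined on a set \<open>A\<close> of full measure. Its values outside \<open>A\<close>
  are irrelevant, since \<open>x \<in> A\<close> and \<open>T x \<in> A\<close> for almost every \<open>x\<close>.\<close>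

definition factor_map ::
  "'a measure \<Rightarrow> ('a \<Rightarrow> 'a) \<Rightarrow> 'b measure \<Rightarrow> ('b \<Rightarrow> 'b) \<Rightarrow> ('a \<Rightarrow> 'b) \<Rightarrow> bool" where
  "factor_map M T N S f \<longleftrightarrow>
     (\<exists>A. full_measure_set M A \<and> measure_preserving_map (restrict_space M A) N f) \<and>
     (AE x in M. f (T x) = S (f x))"

definition factors_onto ::
  "'a measure \<Rightarrow> ('a \<Rightarrow> 'a) \<Rightarrow> 'b measure \<Rightarrow> ('b \<Rightarrow> 'b) \<Rightarrow> bool" where
  "factors_onto M T N S \<longleftrightarrow> (\<exists>f. factor_map M T N S f)"


section \<open>Odometers\<close>

definition odometer_sequence :: "(nat \<Rightarrow> nat) \<Rightarrow> bool" where
  "odometer_sequence k \<longleftrightarrow>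
     (\<forall>n. 1 < k n) \<and> (\<forall>n. k n dvd k (Suc n)) \<and> \<not> bdd_above (range k)"

definition odometer_carrier :: "(nat \<Rightarrow> nat) \<Rightarrow> (nat \<Rightarrow> nat) set" where
  "odometer_carrier k =
     {\<alpha>. (\<forall>n. \<alpha> n < k n) \<and> (\<forall>m n. m \<le> n \<longrightarrow> \<alpha> n mod k m = \<alpha> m)}"

definition odometer_borel :: "(nat \<Rightarrow> nat) \<Rightarrow> (nat \<Rightarrow> nat) measure" where
  "odometer_borel k =
     extend_measure (odometer_carrier k) {(n, i). i < k n}
       (\<lambda>(n, i). {\<alpha> \<in> odometer_carrier k. \<alpha> n = i})
       (\<lambda>(n, i). ennreal (1 / real (k n)))"

text \<open>The completion makes the odometer a transformation of a Lebesgue space.\<close>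

definition odometer_space :: "(nat \<Rightarrow> nat) \<Rightarrow> (nat \<Rightarrow> nat) measure" where
  "odometer_space k = completion (odometer_borel k)"

definition odometer_map :: "(nat \<Rightarrow> nat) \<Rightarrow> (nat \<Rightarrow> nat) \<Rightarrow> (nat \<Rightarrow> nat)" where
  "odometer_map k \<alpha> = (\<lambda>n. (\<alpha> n + 1) mod k n)"

definition odometer_factors :: "(nat \<Rightarrow> nat) \<Rightarrow> nat set" where
  "odometer_factors k = (\<Union>n. {m. 1 \<le> m \<and> m dvd k n})"

text \<open>The constant \<^const>\<open>extend_measure\<close> is only meaningful when an extension exists. It does
  here: push forward the product of uniform measures on the digits of the mixed-radix expansion.\<close>

lemma emeasure_odometer_borel_cylinder:
  assumes k: "odometer_sequence k" and i: "i < k n"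
  shows "emeasure (odometer_borel k) {\<alpha> \<in> odometer_carrier k. \<alpha> n = i} = ennreal (1 / real (k n))"
proof -
  have kpos: "0 < k n" for n using k unfolding odometer_sequence_def by (metis less_trans zero_less_one)
  have kdvd: "k n dvd k (Suc n)" for n :: nat using k by (simp add: odometer_sequence_def)
  have kdvd': "m \<le> n \<Longrightarrow> k m dvd k n" for m n
    by (induction n rule: dec_induct) (auto intro: dvd_trans kdvd)
  define D where "D = (\<lambda>l. case l of 0 \<Rightarrow> k 0 | Suc j \<Rightarrow> k (Suc j) div k j)"
  define F where "F = (\<lambda>(d :: nat \<Rightarrow> nat) n. \<Sum>l\<le>n. (case l of 0 \<Rightarrow> 1 | Suc j \<Rightarrow> k j) * d l)"
  have F0: "F d 0 = d 0" for d by (simp add: F_def)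
  have FS: "F d (Suc n) = F d n + k n * d (Suc n)" for d n by (simp add: F_def)
  have DS: "k (Suc n) = k n * D (Suc n)" for n using kdvd[of n] by (simp add: D_def)
  have Dpos: "0 < D l" for l
  proof (cases l)
    case 0 then show ?thesis using kpos by (simp add: D_def)
  next
    case (Suc j)
    have "k j * D (Suc j) \<noteq> 0" using kpos[of "Suc j"] DS[of j] by simp
    then show ?thesis using Suc by simp
  qed
  have Dprod: "(\<Prod>l\<le>n. D l) = k n" for n
    by (induction n) (simp_all add: DS mult.commute D_def[THEN fun_cong, of 0])
  define U where "U = (\<lambda>l. uniform_count_measure {..<D l})"
  have U: "prob_space (U l)" for l
    unfolding U_def using Dpos[of l] by (intro prob_space_uniform_count_measure) auto
  define P where "P = PiM UNIV U"
  have spP: "space P = {d. \<forall>l. d l < D l}"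
    by (auto simp: P_def space_PiM U_def space_uniform_count_measure)
  have lt: "F d n < k n" if "d \<in> space P" for d n
  proof (induction n)
    case 0 then show ?case using that by (auto simp: F0 spP D_def dest: spec[of _ 0])
  next
    case (Suc n)
    have "Suc (d (Suc n)) \<le> D (Suc n)" using that by (auto simp: spP Suc_le_eq)
    then have "k n * Suc (d (Suc n)) \<le> k (Suc n)" unfolding DS by (rule mult_le_mono2)
    then show ?case using Suc by (simp add: FS)
  qed
  have md: "F d (m + p) mod k m = F d m" if d: "d \<in> space P" for d m p
  proof (induction p)
    case 0 then show ?case using lt[OF d] by simp
  next
    case (Suc p)
    have "k m dvd k (m + p) * d (Suc (m + p))" using kdvd'[of m "m + p"] by auto
    then have "(F d (m + p) + k (m + p) * d (Suc (m + p))) mod k m = F d (m + p) mod k m"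
      by (simp add: mod_add_right_eq mod_add_left_eq dvd_eq_mod_eq_0 flip: mod_add_eq)
    then show ?case using Suc by (simp add: FS)
  qed
  have car: "F d \<in> odometer_carrier k" if "d \<in> space P" for d
    unfolding odometer_carrier_def using lt[OF that] md[OF that] by (auto dest!: le_Suc_ex)
  have dig: "\<exists>c. (\<forall>l\<le>n. c l < D l) \<and> (\<forall>d\<in>space P. F d n = i \<longleftrightarrow> (\<forall>l\<le>n. d l = c l))"
    if "i < k n" for n i
    using that
  proof (induction n arbitrary: i)
    case 0 then show ?case by (intro exI[of _ "\<lambda>_. i"]) (auto simp: F0 D_def)
  next
    case (Suc n)
    obtain c where c: "\<forall>l\<le>n. c l < D l" "\<forall>d\<in>space P. F d n = i mod k n \<longleftrightarrow> (\<forall>l\<le>n. d l = c l)"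
      using Suc.IH[of "i mod k n"] kpos by auto
    have "i div k n < D (Suc n)"
      using Suc.prems by (simp add: DS less_mult_imp_div_less mult.commute)
    moreover have "F d (Suc n) = i \<longleftrightarrow> F d n = i mod k n \<and> d (Suc n) = i div k n"
      if "d \<in> space P" for d
      using lt[OF that, of n] kpos[of n] by (auto simp: FS)
    ultimately show ?case using c
      by (intro exI[of _ "c(Suc n := i div k n)"]) (auto simp: le_Suc_eq)
  qed
  let ?G = "\<lambda>n i. {\<alpha> \<in> odometer_carrier k. \<alpha> n = i}"
  have cyl: "F -` ?G n i \<inter> space P \<in> sets P \<and> emeasure P (F -` ?G n i \<inter> space P) = ennreal (1 / real (k n))"
    if i: "i < k n" for n i
  proof -
    obtain c where c: "\<forall>l\<le>n. c l < D l" "\<forall>d\<in>space P. F d n = i \<longleftrightarrow> (\<forall>l\<le>n. d l = c l)"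
      using dig[OF i] by blast
    have eq: "F -` ?G n i \<inter> space P = prod_emb UNIV U {..n} (Pi\<^sub>E {..n} (\<lambda>l. {c l}))"
      using c(2) car by (auto simp: prod_emb_def P_def space_PiM PiE_iff restrict_def extensional_def)
    have sU: "{c l} \<in> sets (U l)" if "l \<in> {..n}" for l
      using c(1) that by (simp add: U_def sets_uniform_count_measure)
    have "emeasure P (F -` ?G n i \<inter> space P) = (\<Prod>l\<le>n. emeasure (U l) {c l})"
      unfolding eq unfolding P_def using U sU by (intro emeasure_PiM_emb) auto
    also have "\<dots> = (\<Prod>l\<le>n. ennreal (1 / real (D l)))"
      using c(1) by (intro prod.cong) (auto simp: U_def emeasure_uniform_count_measure)
    also have "\<dots> = ennreal (1 / real (k n))"
      by (simp add: prod_ennreal prod_dividef flip: Dprod)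
    finally show ?thesis
      unfolding eq unfolding P_def using sU by (auto intro!: sets_PiM_I)
  qed
  define Q where "Q = sigma (odometer_carrier k) ((\<lambda>(n, i). ?G n i) ` {(n, i). i < k n})"
  have Gsub: "(\<lambda>(n, i). ?G n i) ` {(n, i). i < k n} \<subseteq> Pow (odometer_carrier k)" by auto
  have FQ: "F \<in> P \<rightarrow>\<^sub>M Q"
    unfolding Q_def using Gsub car cyl by (intro measurable_measure_of) auto
  have sets_eq: "sets (odometer_borel k) = sets Q"
    unfolding odometer_borel_def Q_def using Gsub by (simp add: sets_extend_measure)
  show ?thesis
  proof (rule emeasure_extend_measure_Pair[where \<mu>' = "emeasure (distr P Q F)" and I = "\<lambda>n i. i < k n"
        and \<Omega> = "odometer_carrier k" and M = "odometer_borel k" and G = ?G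
        and \<mu> = "\<lambda>n i. ennreal (1 / real (k n))" and i = n and j = i])
    show "odometer_borel k = extend_measure (odometer_carrier k) {(i, j). j < k i} (\<lambda>(i, j). ?G i j)
       (\<lambda>(n, i). ennreal (1 / real (k n)))"
      by (simp add: odometer_borel_def)
    show "emeasure (distr P Q F) (?G n i) = ennreal (1 / real (k n))" if "i < k n" for n i
    proof -
      have "?G n i \<in> sets Q" unfolding Q_def using Gsub that by (auto intro!: sigma_sets.Basic)
      then show ?thesis using FQ cyl[OF that] by (simp add: emeasure_distr)
    qed
    show "positive (sets (odometer_borel k)) (emeasure (distr P Q F))"
      by (simp add: positive_def)
    show "countably_additive (sets (odometer_borel k)) (emeasure (distr P Q F))"
      unfolding sets_eq using emeasure_countably_additive[of "distr P Q F"] by simp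
  qed (use i in auto)
qed


section \<open>Rank-one transformations\<close>

text \<open>Here \<open>r\<close> is the cutting parameter and \<open>s\<close> the spacer parameter; cuts and spacers are indexed
  from 1, and values of \<open>s\<close>, \<open>Bs\<close> and \<open>C\<close> outside the stated index ranges play no role.\<close>

primrec tower_height :: "(nat \<Rightarrow> nat) \<Rightarrow> (nat \<Rightarrow> nat \<Rightarrow> nat) \<Rightarrow> nat \<Rightarrow> nat" where
  "tower_height r s 0 = 1"
| "tower_height r s (Suc n) = r n * tower_height r s n + (\<Sum>i\<in>{0<..r n}. s n i)"

definition tower_levels ::
  "('a \<Rightarrow> 'a) \<Rightarrow> (nat \<Rightarrow> nat) \<Rightarrow> (nat \<Rightarrow> nat \<Rightarrow> nat) \<Rightarrow> (nat \<Rightarrow> 'a set) \<Rightarrow> nat \<Rightarrow> 'a set set" where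
  "tower_levels T r s B n = (\<lambda>k. (T ^^ k) ` B n) ` {..<tower_height r s n}"

text \<open>All set equalities below are literal, not merely modulo null sets. That the
  levels belong to \<open>sets M\<close> is part of the density condition and is stated explicitly, since \<open>T\<close> is invertible only almost everywhere
  and \<^const>\<open>emeasure\<close> is 0 on nonmeasurable sets.\<close>

definition rank_one_data ::
  "'a measure \<Rightarrow> ('a \<Rightarrow> 'a) \<Rightarrow> (nat \<Rightarrow> nat) \<Rightarrow> (nat \<Rightarrow> nat \<Rightarrow> nat) \<Rightarrow>
   (nat \<Rightarrow> 'a set) \<Rightarrow> (nat \<Rightarrow> nat \<Rightarrow> 'a set) \<Rightarrow> (nat \<Rightarrow> nat \<Rightarrow> nat \<Rightarrow> 'a set) \<Rightarrow> bool" where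
  "rank_one_data M T r s B Bs C \<longleftrightarrow>
     (let h = tower_height r s in
       (\<forall>n. 1 < r n) \<and>
       summable (\<lambda>n. (real (h (Suc n)) - real (r n) * real (h n)) / real (h (Suc n))) \<and>
       (\<forall>n. B n \<in> sets M) \<and>
       (\<forall>n. \<forall>i\<in>{0<..r n}. Bs n i \<in> sets M) \<and>
       (\<forall>n. \<forall>i\<in>{0<..r n}. \<forall>j\<in>{0<..s n i}. C n i j \<in> sets M) \<and>
       (\<forall>n. disjoint_family_on (Bs n) {0<..r n} \<and> (\<Union>i\<in>{0<..r n}. Bs n i) = B n) \<and>
       (\<forall>n. disjoint_family_on (\<lambda>k. (T ^^ k) ` B n) {..<h n}) \<and>
       (\<forall>n. \<forall>i\<in>{0<..r n}. s n i \<noteq> 0 \<longrightarrow> (T ^^ h n) ` Bs n i = C n i 1) \<and>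
       (\<forall>n. \<forall>i\<in>{0<..<r n}. s n i = 0 \<longrightarrow> (T ^^ h n) ` Bs n i = Bs n (i + 1)) \<and>
       (\<forall>n. \<forall>i\<in>{0<..r n}. \<forall>j\<in>{0<..<s n i}. T ` C n i j = C n i (j + 1)) \<and>
       (\<forall>n. \<forall>i\<in>{0<..<r n}. s n i \<noteq> 0 \<longrightarrow> T ` C n i (s n i) = Bs n (i + 1)) \<and>
       (\<forall>n. B (Suc n) = Bs n 1) \<and>
       (\<Union>n. tower_levels T r s B n) \<subseteq> sets M \<and>
       (\<forall>A\<in>sets M. \<forall>\<epsilon>::real. \<epsilon> > 0 \<longrightarrow> (\<exists>F. finite F \<and> F \<subseteq> (\<Union>n. tower_levels T r s B n) \<and>
          measure M ((A - \<Union>F) \<union> (\<Union>F - A)) < \<epsilon>)))"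

definition level_indices ::
  "('a \<Rightarrow> 'a) \<Rightarrow> (nat \<Rightarrow> nat) \<Rightarrow> (nat \<Rightarrow> nat \<Rightarrow> nat) \<Rightarrow> (nat \<Rightarrow> 'a set) \<Rightarrow> nat \<Rightarrow> nat \<Rightarrow> nat set" where
  "level_indices T r s B m n = {i. i < tower_height r s n \<and> (T ^^ i) ` B n \<subseteq> B m}"

end

theory Submission
  imports Defs
begin

text \<open>
  The position of a point in the stage-\<open>n\<close> tower is the index of the level that contains it. The
  point of the theorem is that positions are approximate odometer coordinates: for almost every
  \<open>x\<close> and all large \<open>n\<close>, the position of \<open>T x\<close> is the position of \<open>x\<close> plus one
  (\<open>AE_pos_T\<close>), and passing from stage \<open>m\<close> to stage \<open>n\<close> changes the position of a point by an
  element of \<open>I\<^bsub>m,n\<^esub>\<close>. Each index of \<open>I\<^bsub>m,n\<^esub>\<close> accounts for the same share of the mass of the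
  stage-\<open>m\<close> tower, so condition (ii) says that modulo \<open>d\<close> this change is the constant \<open>j\<close>,
  up to a set of measure about \<open>\<eta>\<close>.

  Suppose that (ii) holds. Choose stages \<open>m\<^sub>0 \<le> m\<^sub>1 \<le> \<dots>\<close> such that the change from \<open>m\<^sub>l\<close> to
  \<open>m\<^bsub>l+1\<^esub>\<close> is a constant \<open>j\<^sub>l\<close> modulo \<open>k\<^sub>l\<close> outside a set of measure at most \<open>2 \<cdot> 2\<^bsup>-l\<^esup>\<close>. By
  Borel--Cantelli the positions at stage \<open>m\<^sub>l\<close>, corrected by \<open>j\<^sub>0 + \<dots> + j\<^bsub>l-1\<^esub>\<close>, eventually have
  a constant residue modulo each \<open>k\<^sub>q\<close>, almost everywhere (\<open>stabilizing_positions\<close>). Since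
  the same sequence of corrected positions serves all \<open>q\<close>, the limiting residues are compatible and form a
  point of the odometer, which moves by one step under \<open>T\<close>; so all its cylinders at
  level \<open>q\<close> have equal measure, and the map preserves measure
  (\<open>odometer_factor_of_concentration\<close>). Ergodicity is not needed.

  Conversely, a factor map yields \<open>\<psi> : X \<rightarrow> \<int>/d\<int>\<close> with \<open>\<psi> (T x) = \<psi> x + 1\<close>. The distribution of
  \<open>\<psi>\<close> on a level of a tower is then that on the base, shifted by the index of the level. The
  fibres of \<open>\<psi>\<close> are approximated by unions of levels, and by this shift invariance the
  error is spread evenly over the levels; hence \<open>\<psi>\<close> is nearly constant on \<open>B\<^sub>m\<close>, say equal to \<open>u\<^sub>m\<close>
  (\<open>base_almost_in_fibre\<close>). The level \<open>i \<in> I\<^bsub>m,n\<^esub>\<close> of stage \<open>n\<close> lies in \<open>B\<^sub>m\<close>, while \<open>\<psi>\<close> is nearly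
  \<open>u\<^sub>n + i\<close> on it, so most \<open>i\<close> satisfy \<open>i \<equiv> u\<^sub>m - u\<^sub>n\<close> (\<open>indices_concentrate\<close>).

  One preliminary point is not automatic. The map \<open>T\<close> may be far from injective on a null
  set, and the levels are literal images, so it has to be proved that the levels of one tower have the
  same measure. A set that lies in the top level of every late tower is an atom relative
  to the levels, hence null (\<open>top_levels_null\<close>). So almost every point is eventually below the top,
  and there \<open>T\<close> moves levels to levels exactly (\<open>AE_T_in_lev_Suc_iff\<close>).
\<close>

section \<open>Residues, measurability and odometers\<close>

lemma mod_Suc_eq_iff:
  fixes a b d :: nat
  assumes "a < d" shows "Suc a mod d = Suc b mod d \<longleftrightarrow> a = b mod d"
proof
  assume "Suc a mod d = Suc b mod d"
  then have "(Suc a + (d - 1)) mod d = (Suc b + (d - 1)) mod d" by (metis mod_add_left_eq)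
  moreover have "Suc a + (d - 1) = a + d" "Suc b + (d - 1) = b + d" using assms by auto
  ultimately show "a = b mod d" using assms by simp
qed (simp add: mod_Suc_eq)

lemma measurable_count_space_comp2:
  fixes f :: "'a \<Rightarrow> 'b::countable" and g :: "'a \<Rightarrow> 'c::countable"
  assumes "f \<in> M \<rightarrow>\<^sub>M count_space UNIV" "g \<in> M \<rightarrow>\<^sub>M count_space UNIV"
  shows "(\<lambda>x. F (f x) (g x)) \<in> M \<rightarrow>\<^sub>M count_space UNIV"
proof (rule measurable_compose_countable[where f = "\<lambda>i x. F i (g x)"])
  show "(\<lambda>x. F i (g x)) \<in> M \<rightarrow>\<^sub>M count_space UNIV" for i
    by (rule measurable_compose[OF assms(2)]) simp
qed fact

lemma odometer_sequence_pos: "odometer_sequence k \<Longrightarrow> 0 < k n"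
  by (metis odometer_sequence_def less_trans zero_less_one)

lemma odometer_sequence_dvd:
  assumes "odometer_sequence k" "m \<le> n" shows "k m dvd k n"
  using assms(2) by (induction n rule: dec_induct)
    (use assms(1) in \<open>auto simp: odometer_sequence_def intro: dvd_trans\<close>)

lemma space_odometer_borel [simp]: "space (odometer_borel k) = odometer_carrier k"
  unfolding odometer_borel_def by (rule space_extend_measure) auto

lemma sets_odometer_borel:
  "sets (odometer_borel k) = sigma_sets (odometer_carrier k)
     {{\<alpha> \<in> odometer_carrier k. \<alpha> n = i} |n i. i < k n}"
proof -
  have "sets (odometer_borel k) = sigma_sets (odometer_carrier k)
      ((\<lambda>(n, i). {\<alpha> \<in> odometer_carrier k. \<alpha> n = i}) ` {(n, i). i < k n})"
    unfolding odometer_borel_def by (rule sets_extend_measure) auto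
  also have "(\<lambda>(n, i). {\<alpha> \<in> odometer_carrier k. \<alpha> n = i}) ` {(n, i). i < k n} =
      {{\<alpha> \<in> odometer_carrier k. \<alpha> n = i} |n i. i < k n}" by auto
  finally show ?thesis .
qed

lemma odometer_coordinate_measurable:
  "(\<lambda>\<alpha>. \<alpha> n) \<in> odometer_space k \<rightarrow>\<^sub>M count_space UNIV"
  unfolding odometer_space_def
proof (rule measurable_completion, rule measurable_count_space_eq_countable[THEN iffD2])
  show "(\<lambda>\<alpha>. \<alpha> n) \<in> space (odometer_borel k) \<rightarrow> UNIV \<and>
      (\<forall>i\<in>UNIV. (\<lambda>\<alpha>. \<alpha> n) -` {i} \<inter> space (odometer_borel k) \<in> sets (odometer_borel k))"
  proof (intro conjI ballI)
    fix i
    show "(\<lambda>\<alpha>. \<alpha> n) -` {i} \<inter> space (odometer_borel k) \<in> sets (odometer_borel k)"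
    proof (cases "i < k n")
      case True
      have "(\<lambda>\<alpha>. \<alpha> n) -` {i} \<inter> space (odometer_borel k) = {\<alpha> \<in> odometer_carrier k. \<alpha> n = i}" by auto
      then show ?thesis unfolding sets_odometer_borel using True by (auto intro!: sigma_sets.Basic)
    next
      case False
      then have "(\<lambda>\<alpha>. \<alpha> n) -` {i} \<inter> space (odometer_borel k) = {}"
        by (auto simp: odometer_carrier_def)
      then show ?thesis by simp
    qed
  qed simp
qed simp

text \<open>The cylinders, together with the empty set, are closed under intersection: of two cylinders
  at levels \<open>m \<le> n\<close>, either the second is contained in the first or they are disjoint.\<close>

lemma odometer_measure_eqI:
  assumes k: "odometer_sequence k" and sets: "sets N = sets (odometer_borel k)"
    and cyl: "\<And>n i. i < k n \<Longrightarrow> emeasure N {\<alpha> \<in> odometer_carrier k. \<alpha> n = i} = ennreal (1 / real (k n))"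
  shows "N = odometer_borel k"
proof -
  let ?c = "\<lambda>n i. {\<alpha> \<in> odometer_carrier k. \<alpha> n = i}"
  let ?E = "insert {} {?c n i |n i. i < k n}"
  have inter: "?c m i \<inter> ?c n j \<in> ?E" if "m \<le> n" "j < k n" for m n i j
  proof -
    have "?c m i \<inter> ?c n j = (if j mod k m = i then ?c n j else {})"
      using that(1) by (auto simp: odometer_carrier_def)
    then show ?thesis using that(2) by auto
  qed
  have sets_E: "sets (odometer_borel k) = sigma_sets (odometer_carrier k) ?E"
    unfolding sets_odometer_borel
    by (intro sigma_sets_eqI) (auto intro: sigma_sets.Basic sigma_sets.Empty)
  show ?thesis
  proof (rule measure_eqI_generator_eq_countable[where E = ?E and \<Omega> = "odometer_carrier k"
        and A = "{?c 0 i |i. i < k 0}"])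
    show "Int_stable ?E"
    proof (rule Int_stableI)
      fix a b assume ab: "a \<in> ?E" "b \<in> ?E"
      show "a \<inter> b \<in> ?E"
      proof (cases "a = {} \<or> b = {}")
        case False
        then obtain m i n j where "a = ?c m i" "i < k m" "b = ?c n j" "j < k n" using ab by blast
        then show ?thesis
          using inter[of m n j i] inter[of n m i j] by (cases "m \<le> n") (simp_all add: Int_commute)
      qed auto
    qed
    show "emeasure N X = emeasure (odometer_borel k) X" if "X \<in> ?E" for X
      using that cyl emeasure_odometer_borel_cylinder[OF k] by auto
    show "\<Union>{?c 0 i |i. i < k 0} = odometer_carrier k" by (auto simp: odometer_carrier_def)
    show "emeasure N a \<noteq> \<infinity>" if "a \<in> {?c 0 i |i. i < k 0}" for a
      using that cyl by auto
    show "countable {?c 0 i |i. i < k 0}" by (simp add: setcompr_eq_image)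
  qed (use sets sets_E in auto)
qed

text \<open>Completeness of \<open>M\<close> makes the map measurable for the completed \<open>\<sigma>\<close>-algebra of the odometer.\<close>

lemma measure_preserving_map_odometerI:
  assumes "complete_measure M" and k: "odometer_sequence k"
    and car: "\<And>x. x \<in> space M \<Longrightarrow> \<phi> x \<in> odometer_carrier k"
    and meas: "\<And>n i. i < k n \<Longrightarrow> {x \<in> space M. \<phi> x n = i} \<in> sets M"
    and cyl: "\<And>n i. i < k n \<Longrightarrow> emeasure M {x \<in> space M. \<phi> x n = i} = ennreal (1 / real (k n))"
  shows "measure_preserving_map M (odometer_space k) \<phi>"
proof -
  interpret complete_measure M by fact
  have vim: "\<phi> -` {\<alpha> \<in> odometer_carrier k. \<alpha> n = i} \<inter> space M = {x \<in> space M. \<phi> x n = i}" for n i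
    using car by auto
  have \<phi>: "\<phi> \<in> M \<rightarrow>\<^sub>M odometer_borel k"
  proof (rule measurable_sigma_sets[OF sets_odometer_borel])
    fix A assume "A \<in> {{\<alpha> \<in> odometer_carrier k. \<alpha> n = i} |n i. i < k n}"
    then obtain n i where "i < k n" "A = {\<alpha> \<in> odometer_carrier k. \<alpha> n = i}" by blast
    then show "\<phi> -` A \<inter> space M \<in> sets M" using meas by (simp only: vim)
  qed (use car in auto)
  have "distr M (odometer_borel k) \<phi> = odometer_borel k"
  proof (rule odometer_measure_eqI[OF k])
    fix n i assume i: "i < k n"
    have C: "{\<alpha> \<in> odometer_carrier k. \<alpha> n = i} \<in> sets (odometer_borel k)"
      unfolding sets_odometer_borel using i by (auto intro!: sigma_sets.Basic)
    show "emeasure (distr M (odometer_borel k) \<phi>) {\<alpha> \<in> odometer_carrier k. \<alpha> n = i} = ennreal (1 / real (k n))"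
      unfolding emeasure_distr[OF \<phi> C] vim by (rule cyl[OF i])
  qed simp
  note distr = this
  have \<phi>': "\<phi> \<in> M \<rightarrow>\<^sub>M odometer_space k"
    unfolding odometer_space_def using \<phi> distr by (intro measurable_completion2) auto
  have "distr M (odometer_space k) \<phi> = odometer_space k"
    using completion_distr_eq[OF \<phi>] distr by (simp add: odometer_space_def)
  then have "emeasure M (\<phi> -` A \<inter> space M) = emeasure (odometer_space k) A" if "A \<in> sets (odometer_space k)" for A
    using emeasure_distr[OF \<phi>' that] by simp
  then show ?thesis using \<phi>' by (simp add: measure_preserving_map_def)
qed

section \<open>Systems of towers\<close>

text \<open>The part of the rank-one structure that the argument needs: towers over the bases \<open>B n\<close> with
  heights \<open>h n\<close>, where the base of each tower is a union of levels of the next one, each of these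
  levels starting a full column of height \<open>h n\<close> inside the next tower. The heights and
  the number of columns are otherwise unrestricted. Nonatomicity is assumed in the
  form that every set of positive measure has a subset of strictly intermediate measure.\<close>

locale tower_system = prob_space M for M :: "'a measure" +
  fixes T :: "'a \<Rightarrow> 'a" and h :: "nat \<Rightarrow> nat" and B :: "nat \<Rightarrow> 'a set"
  assumes T_pres: "measure_preserving_map M M T"
    and h_pos: "0 < h n"
    and level_sets: "i < h n \<Longrightarrow> (T ^^ i) ` B n \<in> sets M"
    and levels_disjoint: "disjoint_family_on (\<lambda>i. (T ^^ i) ` B n) {..<h n}"
    and refine_step: "\<exists>R. 0 \<in> R \<and> B n = (\<Union>a\<in>R. (T ^^ a) ` B (Suc n)) \<and> (\<forall>a\<in>R. a + h n \<le> h (Suc n))"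
    and dense: "\<lbrakk>A \<in> sets M; 0 < (e::real)\<rbrakk> \<Longrightarrow>
      \<exists>F. finite F \<and> F \<subseteq> (\<Union>n. (\<lambda>i. (T ^^ i) ` B n) ` {..<h n}) \<and>
        measure M ((A - \<Union>F) \<union> (\<Union>F - A)) < e"
    and nonatomic: "\<lbrakk>A \<in> sets M; 0 < measure M A\<rbrakk> \<Longrightarrow>
      \<exists>A'\<in>sets M. A' \<subseteq> A \<and> 0 < measure M A' \<and> measure M A' < measure M A"
begin

text \<open>The level with index \<open>i\<close> of the tower over \<open>B n\<close>. It is defined for every \<open>i\<close>, but is known to be measurable
  and disjoint from the others only for \<open>i < h n\<close>.\<close>

definition lev :: "nat \<Rightarrow> nat \<Rightarrow> 'a set" where
  "lev n i = (T ^^ i) ` B n"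

text \<open>The index set \<open>I\<^bsub>m,n\<^esub>\<close>.\<close>

definition ind :: "nat \<Rightarrow> nat \<Rightarrow> nat set" where
  "ind m n = {i. i < h n \<and> lev n i \<subseteq> B m}"

text \<open>The subset of the space covered by the stage-\<open>n\<close> tower.\<close>

definition tower :: "nat \<Rightarrow> 'a set" where
  "tower n = (\<Union>i<h n. lev n i)"

lemma T_meas [measurable]: "T \<in> M \<rightarrow>\<^sub>M M"
  using T_pres by (simp add: measure_preserving_map_def)

lemma measure_T_vimage:
  assumes "A \<in> sets M" shows "measure M (T -` A \<inter> space M) = measure M A"
  using T_pres assms by (simp add: measure_preserving_map_def measure_def)

lemma lev_0 [simp]: "lev n 0 = B n"
  by (simp add: lev_def)

lemma lev_sets [measurable]: "i < h n \<Longrightarrow> lev n i \<in> sets M"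
  using level_sets by (simp add: lev_def)

lemma B_sets [measurable]: "B n \<in> sets M"
  using lev_sets[of 0 n] h_pos by simp

lemma tower_sets [measurable]: "tower n \<in> sets M"
  by (auto simp: tower_def)

lemma T_in_lev_Suc: "x \<in> lev n i \<Longrightarrow> T x \<in> lev n (Suc i)"
  by (auto simp: lev_def)

lemma lev_unique: "\<lbrakk>x \<in> lev n i; x \<in> lev n j; i < h n; j < h n\<rbrakk> \<Longrightarrow> i = j"
  using levels_disjoint[of n] by (auto simp: disjoint_family_on_def lev_def)

lemma lev_add: "lev n (i + j) = (T ^^ i) ` lev n j"
  by (simp add: lev_def funpow_add image_comp)

lemma refine:
  assumes "m \<le> n"
  shows "\<exists>R. 0 \<in> R \<and> B m = (\<Union>a\<in>R. lev n a) \<and> (\<forall>a\<in>R. a + h m \<le> h n)"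
  using assms
proof (induction n rule: dec_induct)
  case base
  show ?case by (intro exI[of _ "{0}"]) simp
next
  case (step n)
  obtain R where R: "0 \<in> R" "B m = (\<Union>a\<in>R. lev n a)" "\<forall>a\<in>R. a + h m \<le> h n"
    using step.IH by blast
  obtain S where S: "0 \<in> S" "B n = (\<Union>a\<in>S. lev (Suc n) a)" "\<forall>a\<in>S. a + h n \<le> h (Suc n)"
    using refine_step[of n] by (auto simp: lev_def)
  have "lev n a = (\<Union>b\<in>S. lev (Suc n) (a + b))" for a
    unfolding lev_add lev_def[of n a] S(2) by auto
  then have "B m = (\<Union>c\<in>{a + b |a b. a \<in> R \<and> b \<in> S}. lev (Suc n) c)"
    unfolding R(2) by auto
  moreover have "\<forall>c\<in>{a + b |a b. a \<in> R \<and> b \<in> S}. c + h m \<le> h (Suc n)"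
    using R(3) S(3) by fastforce
  moreover have "0 \<in> {a + b |a b. a \<in> R \<and> b \<in> S}" using R(1) S(1) by auto
  ultimately show ?case by (intro exI[of _ "{a + b |a b. a \<in> R \<and> b \<in> S}"]) simp
qed

text \<open>If one base were empty, then all levels of all towers would be, contradicting density.\<close>

lemma B_nonempty: "B n \<noteq> {}"
proof
  assume e: "B n = {}"
  have "B m = {}" for m
  proof (cases "m \<le> n")
    case True then show ?thesis using refine[OF True] e by (auto simp: lev_def)
  next
    case False
    then obtain R where R: "0 \<in> R" "B n = (\<Union>a\<in>R. lev m a)" using refine[of n m] by auto
    then show ?thesis using e by auto
  qed
  then have *: "F \<subseteq> (\<Union>n. (\<lambda>i. (T ^^ i) ` B n) ` {..<h n}) \<Longrightarrow> \<Union>F = {}" for F by auto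
  obtain F where "F \<subseteq> (\<Union>n. (\<lambda>i. (T ^^ i) ` B n) ` {..<h n})" "measure M ((space M - \<Union>F) \<union> (\<Union>F - space M)) < 1"
    using dense[of "space M" 1] by auto
  then show False using *[of F] prob_space by simp
qed


text \<open>The levels occurring in the refinement of \<open>B m\<close> are exactly those contained in \<open>B m\<close>; here
  it matters that levels are nonempty.\<close>

lemma
  assumes "m \<le> n"
  shows B_refine: "B m = (\<Union>i\<in>ind m n. lev n i)"
    and ind_bound: "i \<in> ind m n \<Longrightarrow> i + h m \<le> h n"
proof -
  obtain R where R: "B m = (\<Union>a\<in>R. lev n a)" "\<forall>a\<in>R. a + h m \<le> h n"
    using refine[OF assms] by blast
  have "R \<subseteq> ind m n"
  proof
    fix a assume "a \<in> R"
    moreover have "0 < h m" by (rule h_pos)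
    ultimately show "a \<in> ind m n" unfolding ind_def using R by fastforce
  qed
  moreover have "ind m n \<subseteq> R"
  proof
    fix i assume i: "i \<in> ind m n"
    obtain x where x: "x \<in> lev n i" using B_nonempty[of n] by (auto simp: lev_def)
    then have "x \<in> B m" using i by (auto simp: ind_def)
    then obtain a where a: "a \<in> R" "x \<in> lev n a" using R by auto
    have "a < h n" using R(2) a(1) h_pos[of m] by fastforce
    then have "a = i" using a(2) x i lev_unique[of x n a i] by (auto simp: ind_def)
    then show "i \<in> R" using a by simp
  qed
  ultimately have "ind m n = R" by simp
  then show "B m = (\<Union>i\<in>ind m n. lev n i)" "i \<in> ind m n \<Longrightarrow> i + h m \<le> h n"
    using R by auto
qed

lemma finite_ind [simp]: "finite (ind m n)"
  by (simp add: ind_def)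

lemma lev_refine:
  assumes "m \<le> n" shows "lev m k = (\<Union>i\<in>ind m n. lev n (i + k))"
proof -
  have "lev m k = (T ^^ k) ` (\<Union>i\<in>ind m n. lev n i)"
    using B_refine[OF assms] by (simp add: lev_def)
  also have "\<dots> = (\<Union>i\<in>ind m n. lev n (k + i))"
    by (simp add: image_UN lev_add)
  finally show ?thesis by (simp add: add.commute)
qed

lemma tower_mono:
  assumes "m \<le> n" shows "tower m \<subseteq> tower n"
proof
  fix x assume "x \<in> tower m"
  then obtain k where k: "k < h m" "x \<in> lev m k" by (auto simp: tower_def)
  then obtain i where i: "i \<in> ind m n" "x \<in> lev n (i + k)"
    using lev_refine[OF assms, of k] by auto
  have "i + k < h n" using ind_bound[OF assms i(1)] k(1) by simp
  then show "x \<in> tower n" using i(2) by (auto simp: tower_def)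
qed

text \<open>Density, with the approximating levels taken from a single tower of any late stage.\<close>

lemma approx:
  assumes "A \<in> sets M" "0 < (e::real)"
  shows "\<exists>N. \<forall>m\<ge>N. \<exists>S\<subseteq>{..<h m}.
    measure M ((A - (\<Union>i\<in>S. lev m i)) \<union> ((\<Union>i\<in>S. lev m i) - A)) < e"
proof -
  obtain F where F: "finite F" "F \<subseteq> (\<Union>n. (\<lambda>i. (T ^^ i) ` B n) ` {..<h n})"
      "measure M ((A - \<Union>F) \<union> (\<Union>F - A)) < e"
    using dense[OF assms] by auto
  have "\<forall>X\<in>F. \<exists>n. \<exists>i<h n. X = lev n i" using F(2) by (fastforce simp: lev_def)
  then obtain st where st: "\<forall>X\<in>F. \<exists>i<h (st X). X = lev (st X) i" by metis
  obtain N where N: "\<forall>X\<in>F. st X \<le> N"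
    using F(1) by (metis Max_ge finite_imageI imageI)
  show ?thesis
  proof (intro exI[of _ N] allI impI)
    fix m assume m: "N \<le> m"
    let ?S = "{j. j < h m \<and> lev m j \<subseteq> \<Union>F}"
    have "\<Union>F \<subseteq> (\<Union>j\<in>?S. lev m j)"
    proof
      fix x assume "x \<in> \<Union>F"
      then obtain X where X: "X \<in> F" "x \<in> X" by auto
      obtain i where i: "i < h (st X)" "X = lev (st X) i" using st X by auto
      have le: "st X \<le> m" using N X(1) m by fastforce
      obtain a where a: "a \<in> ind (st X) m" "x \<in> lev m (a + i)"
        using X(2) i(2) lev_refine[OF le, of i] by auto
      have "a + i < h m" using ind_bound[OF le a(1)] i(1) by simp
      moreover have "lev m (a + i) \<subseteq> X" using i(2) lev_refine[OF le, of i] a(1) by auto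
      ultimately have "a + i \<in> ?S" using X(1) by auto
      then show "x \<in> (\<Union>j\<in>?S. lev m j)" using a(2) by blast
    qed
    then have "\<Union>F = (\<Union>j\<in>?S. lev m j)" by auto
    then show "\<exists>S\<subseteq>{..<h m}.
        measure M ((A - (\<Union>i\<in>S. lev m i)) \<union> ((\<Union>i\<in>S. lev m i) - A)) < e"
      using F(3) by (intro exI[of _ ?S]) auto
  qed
qed

lemma tower_large:
  assumes "0 < (e::real)" shows "\<exists>N. \<forall>m\<ge>N. 1 - e < prob (tower m)"
proof -
  obtain N where N: "\<forall>m\<ge>N. \<exists>S\<subseteq>{..<h m}. measure M ((space M - (\<Union>i\<in>S. lev m i)) \<union> ((\<Union>i\<in>S. lev m i) - space M)) < e"
    using approx[OF sets.top assms] by blast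
  show ?thesis
  proof (intro exI[of _ N] allI impI)
    fix m assume "N \<le> m"
    then obtain S where S: "S \<subseteq> {..<h m}" "prob ((space M - (\<Union>i\<in>S. lev m i)) \<union> ((\<Union>i\<in>S. lev m i) - space M)) < e"
      using N by blast
    have [measurable]: "(\<Union>i\<in>S. lev m i) \<in> sets M"
      using S(1) finite_subset[OF S(1)] by (intro sets.finite_UN) auto
    have "prob (space M - tower m) \<le> prob ((space M - (\<Union>i\<in>S. lev m i)) \<union> ((\<Union>i\<in>S. lev m i) - space M))"
      using S(1) by (intro finite_measure_mono) (auto simp: tower_def)
    then show "1 - e < prob (tower m)" using S(2) by (simp add: prob_compl)
  qed
qed

lemma AE_tower: "AE x in M. \<exists>N. \<forall>n\<ge>N. x \<in> tower n"
proof -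
  have "prob (\<Union>n. tower n) = 1"
  proof (rule antisym)
    show "1 \<le> prob (\<Union>n. tower n)"
    proof (rule field_le_epsilon)
      fix e :: real assume "0 < e"
      then obtain m where "1 - e < prob (tower m)" using tower_large by blast
      moreover have "prob (tower m) \<le> prob (\<Union>n. tower n)" by (intro finite_measure_mono) auto
      ultimately show "1 \<le> prob (\<Union>n. tower n) + e" by simp
    qed
  qed simp
  then have "AE x in M. x \<in> (\<Union>n. tower n)" by (subst (asm) prob_eq_1) auto
  then show ?thesis by eventually_elim (use tower_mono in blast)
qed

text \<open>A set contained in the top level of every late tower is, relative to the levels, an atom: every
  finite union of levels of a late stage contains it or misses it. By density it is null.\<close>

lemma top_levels_null: "prob (\<Inter>n\<in>{N..}. lev n (h n - 1)) = 0"
proof (rule ccontr)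
  define D where "D = (\<Inter>n\<in>{N..}. lev n (h n - 1))"
  have [measurable]: "D \<in> sets M"
    unfolding D_def by (intro sets.countable_INT) (use h_pos in auto)
  assume "prob (\<Inter>n\<in>{N..}. lev n (h n - 1)) \<noteq> 0"
  then have "0 < prob D" using measure_nonneg[of M D] by (simp add: D_def less_le)
  then obtain A where A [measurable]: "A \<in> sets M" and A': "A \<subseteq> D" "0 < prob A" "prob A < prob D"
    using nonatomic[of D] by auto
  \<comment> \<open>A union of levels closer to \<open>A\<close> than \<open>e\<close> can neither contain \<open>D\<close> nor miss it.\<close>
  define e where "e = min (prob A) (prob D - prob A)"
  have "0 < e" using A' by (simp add: e_def)
  then obtain N' where N': "\<forall>m\<ge>N'. \<exists>S\<subseteq>{..<h m}. prob ((A - (\<Union>i\<in>S. lev m i)) \<union> ((\<Union>i\<in>S. lev m i) - A)) < e"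
    using approx[OF A] by blast
  define m where "m = max N N'"
  obtain S where S: "S \<subseteq> {..<h m}" "prob ((A - (\<Union>i\<in>S. lev m i)) \<union> ((\<Union>i\<in>S. lev m i) - A)) < e"
    using N'[rule_format, of m] by (auto simp: m_def)
  have [measurable]: "(\<Union>i\<in>S. lev m i) \<in> sets M"
    using S(1) finite_subset[OF S(1)] by (intro sets.finite_UN) auto
  have Dm: "D \<subseteq> lev m (h m - 1)" by (auto simp: D_def m_def)
  show False
  proof (cases "h m - 1 \<in> S")
    case True
    then have "D - A \<subseteq> (A - (\<Union>i\<in>S. lev m i)) \<union> ((\<Union>i\<in>S. lev m i) - A)" using Dm by auto
    then have "prob (D - A) \<le> prob ((A - (\<Union>i\<in>S. lev m i)) \<union> ((\<Union>i\<in>S. lev m i) - A))"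
      by (intro finite_measure_mono) auto
    moreover have "prob (D - A) = prob D - prob A" using A' by (intro finite_measure_Diff) auto
    ultimately show False using S(2) by (simp add: e_def)
  next
    case False
    have "x \<notin> lev m i" if "x \<in> D" "i \<in> S" for x i
      using lev_unique[of x m "h m - 1" i] that False S(1) Dm h_pos[of m] by auto
    then have "A \<subseteq> (A - (\<Union>i\<in>S. lev m i)) \<union> ((\<Union>i\<in>S. lev m i) - A)" using A' by auto
    then have "prob A \<le> prob ((A - (\<Union>i\<in>S. lev m i)) \<union> ((\<Union>i\<in>S. lev m i) - A))"
      by (intro finite_measure_mono) auto
    then show False using S(2) by (simp add: e_def)
  qed
qed

lemma AE_below_top: "AE x in M. \<exists>n j. Suc j < h n \<and> x \<in> lev n j"
proof -
  have "AE x in M. x \<notin> (\<Inter>n\<in>{N..}. lev n (h n - 1))" for N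
  proof (rule AE_not_in)
    have "(\<Inter>n\<in>{N..}. lev n (h n - 1)) \<in> sets M"
      by (intro sets.countable_INT) (use h_pos in auto)
    then show "(\<Inter>n\<in>{N..}. lev n (h n - 1)) \<in> null_sets M"
      using top_levels_null[of N] by (auto simp: emeasure_eq_measure)
  qed
  then have "AE x in M. \<forall>N. x \<notin> (\<Inter>n\<in>{N..}. lev n (h n - 1))" by (simp add: AE_all_countable)
  then show ?thesis
    using AE_tower
  proof eventually_elim
    case (elim x)
    then obtain N where N: "\<forall>n\<ge>N. x \<in> tower n" by blast
    obtain n where n: "N \<le> n" "x \<notin> lev n (h n - 1)" using elim(1) by auto
    obtain j where j: "j < h n" "x \<in> lev n j" using N n(1) by (auto simp: tower_def)
    have "j \<noteq> h n - 1" using n(2) j(2) by auto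
    then have "Suc j < h n" using j(1) by simp
    then show ?case using j(2) by blast
  qed
qed

lemma AE_below_top_eventually: "AE x in M. \<exists>N. \<forall>n\<ge>N. \<exists>j. Suc j < h n \<and> x \<in> lev n j"
  using AE_below_top
proof eventually_elim
  case (elim x)
  then obtain N j where j: "Suc j < h N" "x \<in> lev N j" by blast
  show ?case
  proof (rule exI[of _ N], intro allI impI)
    fix n assume n: "N \<le> n"
    obtain a where a: "a \<in> ind N n" "x \<in> lev n (a + j)" using j(2) lev_refine[OF n, of j] by auto
    have "Suc (a + j) < h n" using ind_bound[OF n a(1)] j(1) by simp
    then show "\<exists>j. Suc j < h n \<and> x \<in> lev n j" using a(2) by blast
  qed
qed

text \<open>Although \<open>T\<close> need not be injective, almost every point that is mapped into a level comes from the
  level below: at a late stage the point itself lies in a level below the top, and the position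
  of its image determines its own.\<close>

lemma AE_T_in_lev_Suc_iff:
  "AE x in M. \<forall>n j. Suc j < h n \<longrightarrow> (T x \<in> lev n (Suc j) \<longleftrightarrow> x \<in> lev n j)"
  using AE_below_top_eventually
proof eventually_elim
  case (elim x)
  then obtain N where N: "\<forall>n\<ge>N. \<exists>j. Suc j < h n \<and> x \<in> lev n j" by blast
  show ?case
  proof (intro allI impI iffI)
    fix n j assume j: "Suc j < h n" and Tx: "T x \<in> lev n (Suc j)"
    obtain l p where p: "n \<le> l" "Suc p < h l" "x \<in> lev l p" using N[rule_format, of "max n N"] max.cobounded1 max.cobounded2 by blast
    obtain a where a: "a \<in> ind n l" "T x \<in> lev l (a + Suc j)" using Tx lev_refine[OF p(1), of "Suc j"] by auto
    have "a + Suc j < h l" using ind_bound[OF p(1) a(1)] j by simp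
    then have "a + Suc j = Suc p" using lev_unique[OF a(2) T_in_lev_Suc[OF p(3)]] p(2) by simp
    then have "x \<in> lev l (a + j)" using p(3) by simp
    then show "x \<in> lev n j" using lev_refine[OF p(1), of j] a(1) by auto
  qed (rule T_in_lev_Suc)
qed

lemma prob_T_vimage_AE:
  assumes [measurable]: "A \<in> sets M" "A' \<in> sets M" and "AE x in M. T x \<in> A \<longleftrightarrow> x \<in> A'"
  shows "prob A = prob A'"
proof -
  have "prob A = prob (T -` A \<inter> space M)" by (rule measure_T_vimage[symmetric]) fact
  also have "\<dots> = prob A'"
  proof (rule finite_measure_eq_AE)
    show "AE x in M. (x \<in> T -` A \<inter> space M) = (x \<in> A')"
      using assms(3) AE_space by eventually_elim auto
  qed auto
  finally show ?thesis .
qed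

lemma prob_lev:
  assumes "i < h n" shows "prob (lev n i) = prob (B n)"
  using assms
proof (induction i)
  case (Suc i)
  have "prob (lev n (Suc i)) = prob (lev n i)"
  proof (rule prob_T_vimage_AE)
    show "AE x in M. T x \<in> lev n (Suc i) \<longleftrightarrow> x \<in> lev n i"
      using AE_T_in_lev_Suc_iff Suc.prems by auto
  qed (use Suc.prems in auto)
  then show ?case using Suc by simp
qed simp

lemma prob_UN_lev:
  assumes "S \<subseteq> {..<h n}" shows "prob (\<Union>i\<in>S. lev n i) = real (card S) * prob (B n)"
proof -
  have "prob (\<Union>i\<in>S. lev n i) = (\<Sum>i\<in>S. prob (lev n i))"
  proof (rule finite_measure_finite_Union)
    show "disjoint_family_on (lev n) S"
      using levels_disjoint[of n] assms by (auto simp: lev_def disjoint_family_on_def)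
  qed (use assms finite_subset in auto)
  also have "\<dots> = (\<Sum>i\<in>S. prob (B n))" using assms by (intro sum.cong prob_lev) auto
  finally show ?thesis by simp
qed

lemma prob_tower: "prob (tower n) = real (h n) * prob (B n)"
  using prob_UN_lev[of "{..<h n}" n] by (simp add: tower_def)

lemma prob_B_refine: "m \<le> n \<Longrightarrow> prob (B m) = real (card (ind m n)) * prob (B n)"
  by (subst B_refine) (auto simp: ind_def intro!: prob_UN_lev)

lemma prob_B_pos: "0 < prob (B n)"
proof -
  obtain N where N: "\<forall>m\<ge>N. 1 - (1/2) < prob (tower m)" using tower_large[of "1/2"] by auto
  have "0 < prob (tower (max n N))" using N[rule_format, of "max n N"] by simp
  then have *: "0 < prob (B (max n N))" by (simp add: prob_tower zero_less_mult_iff)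
  have "B (max n N) \<subseteq> B n" using refine[of n "max n N"] by force
  then have "prob (B (max n N)) \<le> prob (B n)" by (intro finite_measure_mono) auto
  then show ?thesis using * by simp
qed

text \<open>The position of a point in the stage-\<open>n\<close> tower. Outside the tower its value is
  unspecified.\<close>

definition pos :: "nat \<Rightarrow> 'a \<Rightarrow> nat" where
  "pos n x = (LEAST i. i < h n \<and> x \<in> lev n i)"

lemma pos_eq: "\<lbrakk>x \<in> lev n i; i < h n\<rbrakk> \<Longrightarrow> pos n x = i"
  unfolding pos_def by (rule Least_equality) (use lev_unique[of x n] in auto)

lemma pos_measurable [measurable]: "pos n \<in> M \<rightarrow>\<^sub>M count_space UNIV"
proof -
  have "Measurable.pred M (\<lambda>x. i < h n \<and> x \<in> lev n i)" for i
    by (cases "i < h n") auto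
  then show ?thesis unfolding pos_def by (rule measurable_Least)
qed

lemma AE_pos_T: "AE x in M. \<exists>N. \<forall>n\<ge>N. pos n (T x) = Suc (pos n x)"
  using AE_below_top_eventually
proof eventually_elim
  case (elim x)
  then obtain N where N: "\<forall>n\<ge>N. \<exists>j. Suc j < h n \<and> x \<in> lev n j" by blast
  show ?case
  proof (intro exI[of _ N] allI impI)
    fix n assume "N \<le> n"
    then obtain j where "Suc j < h n" "x \<in> lev n j" using N by blast
    then show "pos n (T x) = Suc (pos n x)" using pos_eq[of x n j] pos_eq[OF T_in_lev_Suc[of x n j]] by simp
  qed
qed

end

section \<open>From equivariant maps to concentration of indices\<close>

context tower_system
begin

text \<open>Fix a measurable map \<open>\<psi>\<close> to \<open>\<int>/d\<int>\<close> that \<open>T\<close> almost everywhere moves by one step.\<close>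

context
  fixes d :: nat and \<psi> :: "'a \<Rightarrow> nat"
  assumes \<psi>_meas [measurable]: "\<psi> \<in> M \<rightarrow>\<^sub>M count_space UNIV"
    and \<psi>_less: "\<psi> x < d"
    and \<psi>_T: "AE x in M. \<psi> (T x) = Suc (\<psi> x) mod d"
begin

text \<open>The fibre of \<open>\<psi>\<close> over \<open>u\<close>.\<close>

definition fibre :: "nat \<Rightarrow> 'a set" where
  "fibre u = {x \<in> space M. \<psi> x = u}"

lemma fibre_sets [measurable]: "fibre u \<in> sets M"
  by (simp add: fibre_def)

lemma prob_lev_fibre:
  assumes "i < h m" shows "prob (lev m i \<inter> fibre ((u + i) mod d)) = prob (B m \<inter> fibre (u mod d))"
  using assms
proof (induction i)
  case (Suc i)
  have "prob (lev m (Suc i) \<inter> fibre ((u + Suc i) mod d)) = prob (lev m i \<inter> fibre ((u + i) mod d))"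
  proof (rule prob_T_vimage_AE)
    show "AE x in M. T x \<in> lev m (Suc i) \<inter> fibre ((u + Suc i) mod d) \<longleftrightarrow> x \<in> lev m i \<inter> fibre ((u + i) mod d)"
      using AE_T_in_lev_Suc_iff \<psi>_T AE_space
    proof eventually_elim
      case (elim x)
      have "T x \<in> space M" using elim(3) measurable_space[OF T_meas] by blast
      moreover have "Suc (\<psi> x) mod d = (u + Suc i) mod d \<longleftrightarrow> \<psi> x = (u + i) mod d"
        using mod_Suc_eq_iff[OF \<psi>_less, of x "u + i"] by simp
      ultimately show ?case using elim Suc.prems by (auto simp: fibre_def)
    qed
  qed (use Suc.prems in auto)
  then show ?case using Suc by simp
qed simp

lemma sum_prob_B_fibre: "(\<Sum>u<d. prob (B m \<inter> fibre u)) = prob (B m)"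
proof -
  have "(\<Sum>u<d. prob (B m \<inter> fibre u)) = prob (\<Union>u<d. B m \<inter> fibre u)"
    by (rule finite_measure_finite_Union[symmetric]) (auto simp: disjoint_family_on_def fibre_def)
  also have "(\<Union>u<d. B m \<inter> fibre u) = B m"
    using \<psi>_less sets.sets_into_space[OF B_sets[of m]] by (auto simp: fibre_def)
  finally show ?thesis .
qed

text \<open>A level \<open>i\<close> meets the fibre over \<open>u + i\<close> in a set whose measure does not depend on \<open>i\<close>. A union
  of levels contains or misses the level \<open>i\<close>, so in approximating this fibre it commits on
  this level an error of at least the minimum below. Summing over the \<open>d\<close> fibres counts every level
  once.\<close>

lemma level_approx_min:
  assumes "0 < (e::real)"
  shows "\<exists>N. \<forall>m\<ge>N. \<forall>u<d.
    real (h m) * min (prob (B m \<inter> fibre u)) (prob (B m) - prob (B m \<inter> fibre u)) \<le> real d * e"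
proof -
  have "\<forall>v. \<exists>N. \<forall>m\<ge>N. \<exists>S\<subseteq>{..<h m}.
      prob ((fibre v - (\<Union>i\<in>S. lev m i)) \<union> ((\<Union>i\<in>S. lev m i) - fibre v)) < e"
    using approx[OF fibre_sets assms] by blast
  then obtain Nv where Nv: "\<And>v m. Nv v \<le> m \<Longrightarrow> \<exists>S\<subseteq>{..<h m}.
      prob ((fibre v - (\<Union>i\<in>S. lev m i)) \<union> ((\<Union>i\<in>S. lev m i) - fibre v)) < e"
    by metis
  show ?thesis
  proof (rule exI[of _ "\<Sum>v<d. Nv v"], intro allI impI)
    fix m u assume m: "(\<Sum>v<d. Nv v) \<le> m" and u: "u < d"
    define c where "c = min (prob (B m \<inter> fibre u)) (prob (B m) - prob (B m \<inter> fibre u))"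
    have part: "(\<Sum>i | i \<in> {..<h m} \<and> (u + i) mod d = v. c) \<le> e" if v: "v < d" for v
    proof -
      have "Nv v \<le> (\<Sum>v<d. Nv v)" using v by (intro member_le_sum) auto
      then obtain S where S: "S \<subseteq> {..<h m}"
          "prob ((fibre v - (\<Union>i\<in>S. lev m i)) \<union> ((\<Union>i\<in>S. lev m i) - fibre v)) < e"
        using Nv[of v m] m by auto
      define D where "D = (fibre v - (\<Union>i\<in>S. lev m i)) \<union> ((\<Union>i\<in>S. lev m i) - fibre v)"
      have [measurable]: "D \<in> sets M"
        unfolding D_def using S(1) finite_subset[OF S(1)]
        by (intro sets.Un sets.Diff sets.finite_UN) auto
      let ?I = "{i. i \<in> {..<h m} \<and> (u + i) mod d = v}"
      have "c \<le> prob (lev m i \<inter> D)" if i: "i \<in> ?I" for i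
      proof -
        have w: "prob (lev m i \<inter> fibre v) = prob (B m \<inter> fibre u)"
          using prob_lev_fibre[of i m u] i u by auto
        show ?thesis
        proof (cases "i \<in> S")
          case True
          have "prob (lev m i - (lev m i \<inter> fibre v)) = prob (lev m i) - prob (lev m i \<inter> fibre v)"
            using i by (intro finite_measure_Diff) auto
          also have "\<dots> = prob (B m) - prob (B m \<inter> fibre u)" using w prob_lev i by auto
          finally have "c \<le> prob (lev m i - (lev m i \<inter> fibre v))" by (simp add: c_def)
          also have "lev m i - (lev m i \<inter> fibre v) \<subseteq> lev m i \<inter> D"
            using True by (auto simp: D_def)
          then have "prob (lev m i - (lev m i \<inter> fibre v)) \<le> prob (lev m i \<inter> D)"
            using i by (intro finite_measure_mono) auto
          finally show ?thesis .
        next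
          case False
          have "x \<notin> lev m k" if "x \<in> lev m i" "k \<in> S" for x k
            using lev_unique[OF that(1), of k] that(2) False S(1) i by auto
          then have "lev m i \<inter> fibre v \<subseteq> lev m i \<inter> D" by (auto simp: D_def)
          then have "prob (lev m i \<inter> fibre v) \<le> prob (lev m i \<inter> D)"
            using i by (intro finite_measure_mono) auto
          then show ?thesis using w by (simp add: c_def)
        qed
      qed
      then have "(\<Sum>i\<in>?I. c) \<le> (\<Sum>i\<in>?I. prob (lev m i \<inter> D))" by (intro sum_mono)
      also have "\<dots> = prob (\<Union>i\<in>?I. lev m i \<inter> D)"
        by (rule finite_measure_finite_Union[symmetric])
          (use lev_unique in \<open>auto simp: disjoint_family_on_def\<close>)
      also have "\<dots> \<le> prob D" by (intro finite_measure_mono) auto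
      finally show ?thesis using S(2) by (simp add: D_def)
    qed
    have "real (h m) * c = (\<Sum>i<h m. c)" by simp
    also have "\<dots> = (\<Sum>v<d. \<Sum>i | i \<in> {..<h m} \<and> (u + i) mod d = v. c)"
      using u by (intro sum.group[symmetric]) auto
    also have "\<dots> \<le> (\<Sum>v<d. e)" by (intro sum_mono) (use part in auto)
    finally show "real (h m) * min (prob (B m \<inter> fibre u)) (prob (B m) - prob (B m \<inter> fibre u)) \<le> real d * e"
      by (simp add: c_def)
  qed
qed

text \<open>Some fibre occupies at least the share \<open>1 / d\<close> of \<open>B m\<close>. For it the minimum in the previous lemma,
  being small compared with \<open>prob (B m)\<close>, can only be the measure of the rest of \<open>B m\<close>.\<close>

lemma base_almost_in_fibre:
  assumes "0 < (\<delta>::real)"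
  shows "\<exists>N. \<forall>m\<ge>N. \<exists>u<d. (1 - \<delta>) * prob (B m) \<le> prob (B m \<inter> fibre u)"
proof -
  have d: "0 < d" using \<psi>_less[of undefined] by simp
  define c where "c = min \<delta> (1 / (2 * real d))"
  have c: "0 < c" using assms d by (simp add: c_def)
  obtain N1 where N1: "\<And>m u. \<lbrakk>N1 \<le> m; u < d\<rbrakk> \<Longrightarrow> real (h m) * min (prob (B m \<inter> fibre u)) (prob (B m) - prob (B m \<inter> fibre u))
      \<le> real d * (c / (2 * real d))"
    using level_approx_min[of "c / (2 * real d)"] c d by auto
  \<comment> \<open>The tower has measure \<open>h m * prob (B m)\<close>; this converts the bound \<open>c / 2\<close> for \<open>h m\<close> times the
      minimum into the bound \<open>c * prob (B m)\<close> for the minimum.\<close>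
  obtain N2 where N2: "\<And>m. N2 \<le> m \<Longrightarrow> 1 - 1/2 < prob (tower m)"
    using tower_large[of "1/2"] by auto
  show ?thesis
  proof (rule exI[of _ "max N1 N2"], intro allI impI)
    fix m assume m: "max N1 N2 \<le> m"
    have "\<exists>u<d. prob (B m) / real d \<le> prob (B m \<inter> fibre u)"
    proof (rule ccontr)
      assume "\<not> ?thesis"
      then have "(\<Sum>u<d. prob (B m \<inter> fibre u)) < (\<Sum>u<d. prob (B m) / real d)"
        using d by (intro sum_strict_mono) (auto simp: not_le)
      then show False using sum_prob_B_fibre[of m] d by simp
    qed
    then obtain u where u: "u < d" "prob (B m) / real d \<le> prob (B m \<inter> fibre u)" by blast
    let ?w = "prob (B m \<inter> fibre u)"
    have "real (h m) * min ?w (prob (B m) - ?w) \<le> c * (1/2)" using N1[of m u] m u(1) d by simp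
    also have "\<dots> < c * (real (h m) * prob (B m))"
      using N2[of m] m c by (intro mult_strict_left_mono) (auto simp: prob_tower)
    finally have "real (h m) * min ?w (prob (B m) - ?w) < real (h m) * (c * prob (B m))" by (simp add: ac_simps)
    then have less: "min ?w (prob (B m) - ?w) < c * prob (B m)"
      using h_pos[of m] by (simp only: mult_less_cancel_left_pos of_nat_0_less_iff)
    have "c * prob (B m) \<le> 1 / (2 * real d) * prob (B m)" by (intro mult_right_mono) (auto simp: c_def)
    also have "\<dots> \<le> prob (B m) / real d" using d by (simp add: field_simps)
    finally have "prob (B m) - ?w < c * prob (B m)" using less u(2) by linarith
    also have "\<dots> \<le> \<delta> * prob (B m)" by (intro mult_right_mono) (auto simp: c_def)
    finally show "\<exists>u<d. (1 - \<delta>) * prob (B m) \<le> prob (B m \<inter> fibre u)"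
      using u(1) by (intro exI[of _ u]) (simp add: algebra_simps)
  qed
qed

lemma indices_concentrate:
  assumes "0 < (\<eta>::real)"
  shows "\<exists>N. \<forall>m n. N \<le> m \<longrightarrow> m \<le> n \<longrightarrow> (\<exists>j\<in>{0..<d}.
    real (card {i \<in> ind m n. i mod d \<noteq> j}) / real (card (ind m n)) < \<eta>)"
proof -
  \<comment> \<open>The fraction obtained is at most \<open>\<delta> / (1 - \<delta>) \<le> 2 * \<delta> < \<eta>\<close>.\<close>
  define \<delta> where "\<delta> = min (1/2) (\<eta>/4)"
  have \<delta>: "0 < \<delta>" "\<delta> \<le> 1/2" "\<delta> \<le> \<eta>/4" using assms by (auto simp: \<delta>_def)
  obtain N where N: "\<And>m. N \<le> m \<Longrightarrow> \<exists>u<d. (1 - \<delta>) * prob (B m) \<le> prob (B m \<inter> fibre u)"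
    using base_almost_in_fibre[OF \<delta>(1)] by blast
  show ?thesis
  proof (rule exI[of _ N], intro allI impI)
    fix m n assume m: "N \<le> m" and mn: "m \<le> n"
    obtain u where u: "u < d" "(1 - \<delta>) * prob (B m) \<le> prob (B m \<inter> fibre u)" using N m by blast
    obtain v where v: "v < d" "(1 - \<delta>) * prob (B n) \<le> prob (B n \<inter> fibre v)" using N[of n] m mn by auto
    \<comment> \<open>That is, \<open>u - v\<close> modulo \<open>d\<close>.\<close>
    define j where "j = (u + (d - v)) mod d"
    define J where "J = {i \<in> ind m n. i mod d \<noteq> j}"
    have J: "i < h n" "lev n i \<subseteq> B m" "(v + i) mod d \<noteq> u" if "i \<in> J" for i
    proof -
      show "i < h n" "lev n i \<subseteq> B m" using that by (auto simp: J_def ind_def)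
      have "i mod d = j" if "(v + i) mod d = u"
      proof -
        have "j = (v + i + (d - v)) mod d" unfolding j_def that[symmetric] by (simp add: mod_add_left_eq)
        also have "v + i + (d - v) = i + d" using v(1) by simp
        finally show ?thesis by simp
      qed
      then show "(v + i) mod d \<noteq> u" using that by (auto simp: J_def)
    qed
    have finJ: "finite J" by (simp add: J_def)
    \<comment> \<open>Each level with index in \<open>J\<close> lies in \<open>B m\<close> and mostly in the fibre over \<open>v + i \<noteq> u\<close>, but \<open>B m\<close>
        has little room outside the fibre over \<open>u\<close>.\<close>
    have "real (card J) * ((1 - \<delta>) * prob (B n)) = (\<Sum>i\<in>J. (1 - \<delta>) * prob (B n))" by simp
    also have "\<dots> \<le> (\<Sum>i\<in>J. prob (lev n i \<inter> fibre ((v + i) mod d)))"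
      using v J by (intro sum_mono) (simp add: prob_lev_fibre)
    also have "\<dots> = prob (\<Union>i\<in>J. lev n i \<inter> fibre ((v + i) mod d))"
      by (rule finite_measure_finite_Union[symmetric])
        (use finJ J lev_unique in \<open>auto simp: disjoint_family_on_def\<close>)
    also have "\<dots> \<le> prob (B m - (B m \<inter> fibre u))"
    proof (rule finite_measure_mono)
      show "(\<Union>i\<in>J. lev n i \<inter> fibre ((v + i) mod d)) \<subseteq> B m - (B m \<inter> fibre u)"
      proof (rule UN_least)
        fix i assume "i \<in> J"
        then show "lev n i \<inter> fibre ((v + i) mod d) \<subseteq> B m - (B m \<inter> fibre u)"
          using J(2)[of i] J(3)[of i] by (auto simp: fibre_def)
      qed
    qed simp
    also have "\<dots> = prob (B m) - prob (B m \<inter> fibre u)" by (intro finite_measure_Diff) auto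
    also have "\<dots> \<le> \<delta> * prob (B m)" using u(2) by (simp add: algebra_simps)
    also have "\<dots> = \<delta> * real (card (ind m n)) * prob (B n)" using prob_B_refine[OF mn] by simp
    finally have "(real (card J) * (1 - \<delta>)) * prob (B n) \<le> (\<delta> * real (card (ind m n))) * prob (B n)"
      by (simp add: ac_simps)
    then have le: "real (card J) * (1 - \<delta>) \<le> \<delta> * real (card (ind m n))"
      using prob_B_pos[of n] by simp
    have "0 < real (card (ind m n)) * prob (B n)" using prob_B_pos[of m] prob_B_refine[OF mn] by simp
    then have pos: "0 < real (card (ind m n))" by (simp add: zero_less_mult_iff)
    have "real (card J) * (1/2) \<le> real (card J) * (1 - \<delta>)" using \<delta> by (intro mult_left_mono) auto
    also have "\<dots> \<le> \<eta>/4 * real (card (ind m n))" using le \<delta>(3) pos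
      by (meson mult_right_mono less_imp_le order_trans)
    finally have "real (card J) \<le> \<eta>/2 * real (card (ind m n))" by simp
    also have "\<dots> < \<eta> * real (card (ind m n))" using assms pos by (intro mult_strict_right_mono) auto
    finally have "real (card J) / real (card (ind m n)) < \<eta>" using pos by (simp add: divide_less_eq)
    moreover have "j \<in> {0..<d}" using u(1) by (simp add: j_def)
    ultimately show "\<exists>j\<in>{0..<d}. real (card {i \<in> ind m n. i mod d \<noteq> j}) / real (card (ind m n)) < \<eta>"
      by (auto simp: J_def)
  qed
qed

end

text \<open>The residue modulo \<open>d\<close> of the coordinate \<open>q\<close> of a factor map is a map to which
  \<open>indices_concentrate\<close> applies. Outside the set on which the factor map is measurable
  it is replaced by \<open>0\<close>.\<close>

lemma concentration_of_odometer_factor: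
  assumes k: "odometer_sequence k" and dq: "d dvd k q"
    and fac: "factors_onto M T (odometer_space k) (odometer_map k)" and "0 < (\<eta>::real)"
  shows "\<exists>N. \<forall>m n. N \<le> m \<longrightarrow> m \<le> n \<longrightarrow> (\<exists>j\<in>{0..<d}.
    real (card {i \<in> ind m n. i mod d \<noteq> j}) / real (card (ind m n)) < \<eta>)"
proof -
  obtain f A where A: "full_measure_set M A"
    and f: "measure_preserving_map (restrict_space M A) (odometer_space k) f"
    and f_T: "AE x in M. f (T x) = odometer_map k (f x)"
    using fac by (auto simp: factors_onto_def factor_map_def)
  have A_sets [measurable]: "A \<in> sets M" and A_full: "AE x in M. x \<in> A"
  proof -
    show 1: "A \<in> sets M" using A by (simp add: full_measure_set_def)
    have "space M - A \<in> null_sets M" using A by (auto simp: full_measure_set_def)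
    then have "AE x in M. x \<notin> space M - A" by (rule AE_not_in)
    then show "AE x in M. x \<in> A" using AE_space by eventually_elim auto
  qed
  have d: "0 < d" using dq odometer_sequence_pos[OF k, of q] by (auto intro: Nat.gr0I)
  define \<psi> where "\<psi> = (\<lambda>x. if x \<in> A then f x q mod d else 0)"
  have "(\<lambda>x. f x q) \<in> restrict_space M A \<rightarrow>\<^sub>M count_space UNIV"
    using f measurable_compose[OF _ odometer_coordinate_measurable] by (auto simp: measure_preserving_map_def)
  then have "(\<lambda>x. f x q mod d) \<in> restrict_space M A \<rightarrow>\<^sub>M count_space UNIV"
    by (rule measurable_compose) simp
  then have "\<psi> \<in> M \<rightarrow>\<^sub>M count_space UNIV"
    unfolding \<psi>_def by (subst (asm) measurable_restrict_space_iff[where c = 0]) auto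
  moreover have "\<psi> x < d" for x using d by (simp add: \<psi>_def)
  moreover have "AE x in M. \<psi> (T x) = Suc (\<psi> x) mod d"
  proof -
    have "AE x in M. T x \<in> A"
    proof (rule AE_I')
      show "T -` (space M - A) \<inter> space M \<in> null_sets M"
        using A T_pres by (auto simp: full_measure_set_def measure_preserving_map_def null_sets_def)
      show "{x \<in> space M. T x \<notin> A} \<subseteq> T -` (space M - A) \<inter> space M"
        using measurable_space[OF T_meas] by auto
    qed
    then show ?thesis using A_full f_T
    proof eventually_elim
      case (elim x)
      then have "\<psi> (T x) = Suc (f x q) mod k q mod d" by (simp add: \<psi>_def odometer_map_def)
      also have "\<dots> = Suc (f x q) mod d" using dq by (rule mod_mod_cancel)
      also have "\<dots> = Suc (\<psi> x) mod d" using elim by (simp add: \<psi>_def mod_Suc_eq)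
      finally show ?case .
    qed
  qed
  ultimately show ?thesis using \<open>0 < \<eta>\<close> by (rule indices_concentrate)
qed

end

section \<open>From concentration of indices to odometer factors\<close>

context tower_system
begin

text \<open>Outside the stage-\<open>m\<close> tower nothing is known about positions. Inside it, the position changes by
  a residue other than \<open>j\<close> exactly on the columns over the exceptional indices.\<close>

lemma prob_pos_shift:
  assumes mn: "m \<le> n"
    and ratio: "real (card {i \<in> ind m n. i mod d \<noteq> j}) / real (card (ind m n)) < \<eta>"
  shows "{x \<in> space M. pos n x mod d \<noteq> (pos m x + j) mod d} \<in> sets M" (is "?E \<in> _")
    and "prob {x \<in> space M. pos n x mod d \<noteq> (pos m x + j) mod d} \<le> 1 - prob (tower m) + \<eta>"
proof -
  have "Measurable.pred M (\<lambda>x. pos n x mod d \<noteq> (pos m x + j) mod d)"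
    by (rule measurable_count_space_comp2[where F = "\<lambda>a b. a mod d \<noteq> (b + j) mod d"]) (rule pos_measurable)+
  then show E [measurable]: "?E \<in> sets M" by measurable
  let ?J = "{i \<in> ind m n. i mod d \<noteq> j}"
  let ?P = "{..<h m} \<times> ?J"
  have bnd: "i + a < h n" if "(a, i) \<in> ?P" for a i
    using that ind_bound[OF mn, of i] by auto
  have "?E \<subseteq> (space M - tower m) \<union> (\<Union>(a,i)\<in>?P. lev n (i + a))"
  proof
    fix x assume x: "x \<in> ?E"
    show "x \<in> (space M - tower m) \<union> (\<Union>(a,i)\<in>?P. lev n (i + a))"
    proof (cases "x \<in> tower m")
      case True
      then obtain a where a: "a < h m" "x \<in> lev m a" by (auto simp: tower_def)
      then obtain i where i: "i \<in> ind m n" "x \<in> lev n (i + a)" using lev_refine[OF mn, of a] by auto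
      have "i + a < h n" using ind_bound[OF mn i(1)] a(1) by simp
      then have "pos n x = i + pos m x" using pos_eq a i(2) by simp
      then have "i mod d \<noteq> j" using x by (auto simp: ac_simps mod_add_left_eq mod_add_right_eq)
      then show ?thesis using a(1) i by auto
    qed (use x in auto)
  qed
  moreover have U [measurable]: "(\<Union>(a,i)\<in>?P. lev n (i + a)) \<in> sets M"
    using bnd by (intro sets.finite_UN) auto
  ultimately have "prob ?E \<le> prob ((space M - tower m) \<union> (\<Union>(a,i)\<in>?P. lev n (i + a)))"
    by (intro finite_measure_mono) auto
  also have "\<dots> \<le> prob (space M - tower m) + prob (\<Union>(a,i)\<in>?P. lev n (i + a))"
    by (intro measure_Un_le) auto
  also have "prob (space M - tower m) = 1 - prob (tower m)" by (simp add: prob_compl)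
  also have "prob (\<Union>(a,i)\<in>?P. lev n (i + a)) \<le> (\<Sum>p\<in>?P. prob (case p of (a, i) \<Rightarrow> lev n (i + a)))"
    using bnd by (intro finite_measure_subadditive_finite) auto
  also have "\<dots> = (\<Sum>p\<in>?P. prob (B n))" using bnd by (intro sum.cong) (auto simp: prob_lev)
  also have "\<dots> = real (h m) * (real (card ?J) * prob (B n))" by (simp add: card_cartesian_product)
  also have "\<dots> \<le> \<eta>"
  proof -
    have "0 < real (card (ind m n)) * prob (B n)" using prob_B_pos[of m] prob_B_refine[OF mn] by simp
    then have "0 < real (card (ind m n))" by (simp add: zero_less_mult_iff)
    then have "real (card ?J) \<le> \<eta> * real (card (ind m n))"
      using ratio by (simp add: divide_less_eq)
    have "0 \<le> real (card ?J) / real (card (ind m n))" by simp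
    then have "0 \<le> \<eta>" using ratio by linarith
    have "real (card ?J) * prob (B n) \<le> \<eta> * real (card (ind m n)) * prob (B n)"
      by (intro mult_right_mono) (fact, simp)
    also have "\<dots> = \<eta> * prob (B m)" by (simp add: prob_B_refine[OF mn])
    finally have "real (card ?J) * prob (B n) \<le> \<eta> * prob (B m)" .
    then have "real (h m) * (real (card ?J) * prob (B n)) \<le> real (h m) * (\<eta> * prob (B m))"
      by (intro mult_left_mono) auto
    also have "\<dots> = \<eta> * prob (tower m)" by (simp add: prob_tower)
    also have "\<dots> \<le> \<eta> * 1" using \<open>0 \<le> \<eta>\<close> by (intro mult_left_mono) auto
    finally show ?thesis by simp
  qed
  finally show "prob ?E \<le> 1 - prob (tower m) + \<eta>" by simp
qed

text \<open>At step \<open>l\<close> the modulus is \<open>k l\<close>; since \<open>k q\<close> divides \<open>k l\<close> for \<open>l \<ge> q\<close>, one sequence of stages and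
  corrections serves all moduli.\<close>

lemma stabilizing_positions:
  assumes k: "odometer_sequence k"
    and conc: "\<And>q \<eta>. 0 < (\<eta>::real) \<Longrightarrow> \<exists>N. \<forall>m n. N \<le> m \<longrightarrow> m \<le> n \<longrightarrow> (\<exists>j\<in>{0..<k q}.
      real (card {i \<in> ind m n. i mod k q \<noteq> j}) / real (card (ind m n)) < \<eta>)"
  obtains st b where "\<And>l. l \<le> st l"
    and "AE x in M. \<forall>q. \<exists>v L. \<forall>l\<ge>L. (pos (st l) x + b l) mod k q = v"
proof -
  have "\<forall>l. \<exists>N. \<forall>m n. N \<le> m \<longrightarrow> m \<le> n \<longrightarrow> (\<exists>j\<in>{0..<k l}.
      real (card {i \<in> ind m n. i mod k l \<noteq> j}) / real (card (ind m n)) < (1/2)^l)"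
    using conc by simp
  from choice[OF this] obtain N1 where N1: "\<And>l m n. \<lbrakk>N1 l \<le> m; m \<le> n\<rbrakk> \<Longrightarrow> \<exists>j\<in>{0..<k l}.
      real (card {i \<in> ind m n. i mod k l \<noteq> j}) / real (card (ind m n)) < (1/2)^l"
    by blast
  have "\<forall>l::nat. \<exists>N. \<forall>m\<ge>N. 1 - (1/2)^l < prob (tower m)"
    using tower_large by simp
  then obtain N2 where N2: "\<And>l m. N2 l \<le> m \<Longrightarrow> 1 - (1/2)^l < prob (tower m)" by metis
  define st where "st = (\<lambda>l. l + (\<Sum>i\<le>l. N1 i + N2 i))"
  have st: "l \<le> st l" "N1 l \<le> st l" "N2 l \<le> st l" "st l \<le> st (Suc l)" for l
  proof -
    have "N1 l + N2 l \<le> (\<Sum>i\<le>l. N1 i + N2 i)" by (rule member_le_sum) auto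
    then show "l \<le> st l" "N1 l \<le> st l" "N2 l \<le> st l" "st l \<le> st (Suc l)" by (auto simp: st_def)
  qed
  have "\<forall>l. \<exists>j. j < k l \<and>
      real (card {i \<in> ind (st l) (st (Suc l)). i mod k l \<noteq> j}) / real (card (ind (st l) (st (Suc l)))) < (1/2)^l"
    using N1[OF st(2) st(4)] by fastforce
  from choice[OF this] obtain j where j: "\<And>l. j l < k l" "\<And>l.
      real (card {i \<in> ind (st l) (st (Suc l)). i mod k l \<noteq> j l}) / real (card (ind (st l) (st (Suc l)))) < (1/2)^l"
    by blast
  define E where "E = (\<lambda>l. {x \<in> space M. pos (st (Suc l)) x mod k l \<noteq> (pos (st l) x + j l) mod k l})"
  have E_sets: "E l \<in> sets M" for l
    unfolding E_def by (rule prob_pos_shift(1)[OF st(4) j(2)])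
  have "prob (E l) \<le> 2 * (1/2)^l" for l
  proof -
    have "prob (E l) \<le> 1 - prob (tower (st l)) + (1/2)^l"
      unfolding E_def by (rule prob_pos_shift(2)[OF st(4) j(2)])
    then show ?thesis using N2[OF st(3), of l] by simp
  qed
  then have "summable (\<lambda>l. prob (E l))"
    by (intro summable_comparison_test'[OF summable_mult[OF summable_geometric], of "1/2" 0 _ 2]) auto
  then have AE_E: "AE x in M. eventually (\<lambda>l. x \<in> space M - E l) sequentially"
    using E_sets by (intro borel_cantelli_AE1) (auto simp: emeasure_eq_measure)
  \<comment> \<open>Subtracting \<open>j i\<close> is the same modulo \<open>k i\<close> as adding \<open>k i - j i\<close>, and stays in the natural
      numbers.\<close>
  define b where "b = (\<lambda>l. \<Sum>i<l. k i - j i)"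
  have step_eq: "(pos (st (Suc l)) x + b (Suc l)) mod k l = (pos (st l) x + b l) mod k l"
    if "x \<in> space M - E l" for x l
  proof -
    have eq: "pos (st (Suc l)) x mod k l = (pos (st l) x + j l) mod k l" using that by (auto simp: E_def)
    have "(pos (st (Suc l)) x + b (Suc l)) mod k l = (pos (st (Suc l)) x + (b l + (k l - j l))) mod k l"
      by (simp add: b_def)
    also have "\<dots> = (pos (st l) x + j l + (b l + (k l - j l))) mod k l"
      using eq by (rule mod_add_cong) simp
    also have "pos (st l) x + j l + (b l + (k l - j l)) = pos (st l) x + b l + k l" using j(1)[of l] by simp
    finally show ?thesis by simp
  qed
  have "AE x in M. \<forall>q. \<exists>v L. \<forall>l\<ge>L. (pos (st l) x + b l) mod k q = v"
    using AE_E
  proof eventually_elim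
    case (elim x)
    then obtain L where L: "\<And>l. L \<le> l \<Longrightarrow> x \<in> space M - E l" by (auto simp: eventually_sequentially)
    show ?case
    proof
      fix q
      let ?L = "max L q"
      have "(pos (st l) x + b l) mod k q = (pos (st ?L) x + b ?L) mod k q" if "?L \<le> l" for l
        using that
      proof (induction l rule: dec_induct)
        case (step l)
        have dvd: "k q dvd k l" using odometer_sequence_dvd[OF k, of q l] step.hyps by simp
        have "(pos (st (Suc l)) x + b (Suc l)) mod k l mod k q = (pos (st l) x + b l) mod k l mod k q"
          using step_eq[OF L[of l]] step.hyps by simp
        then have "(pos (st (Suc l)) x + b (Suc l)) mod k q = (pos (st l) x + b l) mod k q"
          by (simp add: mod_mod_cancel[OF dvd])
        then show ?case using step.IH by simp
      qed simp
      then show "\<exists>v L. \<forall>l\<ge>L. (pos (st l) x + b l) mod k q = v" by blast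
    qed
  qed
  then show ?thesis using that st(1) by blast
qed

lemma odometer_factor_of_concentration:
  assumes compl: "complete_measure M" and k: "odometer_sequence k"
    and conc: "\<And>q \<eta>. 0 < (\<eta>::real) \<Longrightarrow> \<exists>N. \<forall>m n. N \<le> m \<longrightarrow> m \<le> n \<longrightarrow> (\<exists>j\<in>{0..<k q}.
      real (card {i \<in> ind m n. i mod k q \<noteq> j}) / real (card (ind m n)) < \<eta>)"
  shows "factors_onto M T (odometer_space k) (odometer_map k)"
proof -
  obtain st b where st: "\<And>l. l \<le> st l"
    and AE_conv: "AE x in M. \<forall>q. \<exists>v L. \<forall>l\<ge>L. (pos (st l) x + b l) mod k q = v"
    using stabilizing_positions[OF k conc] by blast
  define c where "c = (\<lambda>l x. pos (st l) x + b l)"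
  define conv where "conv = (\<lambda>x. \<forall>q. \<exists>v L. \<forall>l\<ge>L. c l x mod k q = v)"
  define \<phi> where "\<phi> = (\<lambda>x q. if conv x then LEAST v. \<exists>L. \<forall>l\<ge>L. c l x mod k q = v else 0)"
  have kpos: "0 < k q" for q using odometer_sequence_pos[OF k] .
  have \<phi>_lim: "\<exists>L. \<forall>l\<ge>L. c l x mod k q = \<phi> x q" if "conv x" for x q
  proof -
    have "\<exists>v L. \<forall>l\<ge>L. c l x mod k q = v" using that by (simp add: conv_def)
    then show ?thesis unfolding \<phi>_def using that by (simp only: if_True) (rule LeastI_ex)
  qed
  have \<phi>_eqI: "\<phi> x q = v" if cv: "conv x" and lim: "\<forall>l\<ge>L. c l x mod k q = v" for x q v L
  proof -
    obtain L' where "\<forall>l\<ge>L'. c l x mod k q = \<phi> x q" using \<phi>_lim[OF cv] by blast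
    then have "c (max L L') x mod k q = \<phi> x q" by simp
    moreover have "c (max L L') x mod k q = v" using lim by simp
    ultimately show ?thesis by simp
  qed
  have \<phi>_less: "\<phi> x q < k q" for x q
  proof (cases "conv x")
    case True
    then obtain L where "\<forall>l\<ge>L. c l x mod k q = \<phi> x q" using \<phi>_lim by blast
    then have "\<phi> x q = c L x mod k q" by simp
    then show ?thesis using kpos by simp
  qed (simp add: \<phi>_def kpos)
  have \<phi>_mod: "\<phi> x n mod k m = \<phi> x m" if "m \<le> n" for x m n
  proof (cases "conv x")
    case True
    then obtain L where L: "\<forall>l\<ge>L. c l x mod k n = \<phi> x n" using \<phi>_lim by blast
    have "\<forall>l\<ge>L. c l x mod k m = \<phi> x n mod k m"
      using L mod_mod_cancel[OF odometer_sequence_dvd[OF k that]] by metis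
    then show ?thesis using \<phi>_eqI[OF True] by simp
  qed (simp add: \<phi>_def)
  have car: "\<phi> x \<in> odometer_carrier k" for x
    using \<phi>_less \<phi>_mod by (simp add: odometer_carrier_def)
  have [measurable]: "c l \<in> M \<rightarrow>\<^sub>M count_space UNIV" for l
    unfolding c_def by (rule measurable_compose[OF pos_measurable]) simp
  have c_eq [measurable]: "Measurable.pred M (\<lambda>x. c l x mod k q = v)" for l q v
    using measurable_compose[of "c l" M "count_space UNIV" "\<lambda>a. a mod k q = v"] by simp
  have [measurable]: "Measurable.pred M conv"
    unfolding conv_def by measurable
  have \<phi>_meas [measurable]: "(\<lambda>x. \<phi> x q) \<in> M \<rightarrow>\<^sub>M count_space UNIV" for q
    unfolding \<phi>_def by measurable
  \<comment> \<open>For almost every point, positions increase by one under \<open>T\<close> at all late stages.\<close>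
  have AE_T: "AE x in M. \<phi> (T x) = odometer_map k (\<phi> x)"
    using AE_conv AE_pos_T
  proof eventually_elim
    case (elim x)
    then have conv: "conv x" by (simp add: conv_def c_def)
    obtain N where N: "\<And>n. N \<le> n \<Longrightarrow> pos n (T x) = Suc (pos n x)" using elim by blast
    have c_T: "c l (T x) = Suc (c l x)" if "N \<le> l" for l
      using N[of "st l"] st[of l] that by (simp add: c_def)
    have lim: "\<exists>L. \<forall>l\<ge>L. c l (T x) mod k q = Suc (\<phi> x q) mod k q" for q
    proof -
      obtain L where L: "\<forall>l\<ge>L. c l x mod k q = \<phi> x q" using \<phi>_lim[OF conv] by blast
      have "c l (T x) mod k q = Suc (\<phi> x q) mod k q" if "max N L \<le> l" for l
        using c_T[of l] L[rule_format, of l, symmetric] that by (simp add: mod_Suc_eq)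
      then show ?thesis by blast
    qed
    then have "conv (T x)" unfolding conv_def by blast
    then have "\<phi> (T x) q = Suc (\<phi> x q) mod k q" for q
      using \<phi>_eqI lim[of q] by blast
    then show ?case by (auto simp: odometer_map_def)
  qed
  have P_sets [measurable]: "{x \<in> space M. \<phi> x q = i} \<in> sets M" for q i
    using measurable_sets[OF \<phi>_meas[of q], of "{i}"] by (simp add: vimage_def Int_def conj_commute)
  \<comment> \<open>\<open>T\<close> permutes the \<open>k q\<close> cylinders of level \<open>q\<close> cyclically, so they have equal measure.\<close>
  have P0: "prob {x \<in> space M. \<phi> x q = i} = prob {x \<in> space M. \<phi> x q = 0}" if "i < k q" for q i
    using that
  proof (induction i)
    case (Suc i)
    have "prob {x \<in> space M. \<phi> x q = Suc i} = prob {x \<in> space M. \<phi> x q = i}"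
    proof (rule prob_T_vimage_AE)
      show "AE x in M. T x \<in> {x \<in> space M. \<phi> x q = Suc i} \<longleftrightarrow> x \<in> {x \<in> space M. \<phi> x q = i}"
        using AE_T AE_space
      proof eventually_elim
        case (elim x)
        have "T x \<in> space M" using elim(2) measurable_space[OF T_meas] by blast
        moreover have "\<phi> (T x) q = Suc (\<phi> x q) mod k q" using elim(1) by (simp add: odometer_map_def)
        moreover have "Suc (\<phi> x q) mod k q = Suc i mod k q \<longleftrightarrow> \<phi> x q = i mod k q"
          by (rule mod_Suc_eq_iff[OF \<phi>_less])
        ultimately show ?case using elim(2) Suc.prems by simp
      qed
    qed (rule P_sets)+
    then show ?case using Suc by simp
  qed simp
  have P: "prob {x \<in> space M. \<phi> x q = i} = 1 / real (k q)" if "i < k q" for q i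
  proof -
    have "(\<Sum>i<k q. prob {x \<in> space M. \<phi> x q = i}) = prob (\<Union>i<k q. {x \<in> space M. \<phi> x q = i})"
      by (rule finite_measure_finite_Union[symmetric]) (auto simp: disjoint_family_on_def)
    also have "(\<Union>i<k q. {x \<in> space M. \<phi> x q = i}) = space M" using \<phi>_less by auto
    finally have "(\<Sum>i<k q. prob {x \<in> space M. \<phi> x q = i}) = 1" by (simp add: prob_space)
    moreover have "(\<Sum>i<k q. prob {x \<in> space M. \<phi> x q = i}) = (\<Sum>i<k q. prob {x \<in> space M. \<phi> x q = 0})"
      by (intro sum.cong refl P0) simp
    ultimately have "real (k q) * prob {x \<in> space M. \<phi> x q = 0} = 1" by simp
    then show ?thesis using P0[OF that] kpos[of q] by (simp add: field_simps)
  qed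
  have "measure_preserving_map M (odometer_space k) \<phi>"
    by (rule measure_preserving_map_odometerI[OF compl k])
      (use car P in \<open>auto simp: emeasure_eq_measure\<close>)
  moreover have "restrict_space M (space M) = M"
    by (rule measure_eqI)
      (auto simp: sets_restrict_space sets.Int_space_eq1 dest: sets.sets_into_space intro!: emeasure_restrict_space)
  moreover have "full_measure_set M (space M)" by (simp add: full_measure_set_def)
  ultimately have "factor_map M T (odometer_space k) (odometer_map k) \<phi>"
    unfolding factor_map_def using AE_T by (intro conjI exI[of _ "space M"]) simp_all
  then show ?thesis by (auto simp: factors_onto_def)
qed

end

section \<open>Rank-one transformations as systems of towers\<close>

text \<open>Cutting the unit interval into short pieces and pulling them back cuts a set of positive measure
  into pieces of smaller measure.\<close>

lemma nonatomic_of_standard: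
  assumes "nonatomic_standard_Lebesgue_space M" and A: "A \<in> sets M" "0 < measure M A"
  shows "\<exists>A'\<in>sets M. A' \<subseteq> A \<and> 0 < measure M A' \<and> measure M A' < measure M A"
proof -
  interpret prob_space M using assms(1) by (simp add: nonatomic_standard_Lebesgue_space_def)
  let ?L = "restrict_space lebesgue {0..1::real}"
  obtain f where "mp_isomorphism M ?L f"
    using assms(1) by (auto simp only: nonatomic_standard_Lebesgue_space_def)
  then have "measure_preserving_map M ?L f" by (simp only: mp_isomorphism_def)
  then have f: "f \<in> M \<rightarrow>\<^sub>M ?L" "\<And>S. S \<in> sets ?L \<Longrightarrow> emeasure M (f -` S \<inter> space M) = emeasure ?L S" for S
    by (auto simp only: measure_preserving_map_def)
  obtain n where n: "inverse (real (Suc n)) < measure M A" using reals_Archimedean[OF A(2)] by blast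
  define J where "J = (\<lambda>i. {real i / real (Suc n) ..< real (Suc i) / real (Suc n)} \<inter> {0..1})"
  have J: "J i \<in> sets ?L" "emeasure ?L (J i) \<le> ennreal (inverse (real (Suc n)))" for i
  proof -
    show "J i \<in> sets ?L"
      unfolding J_def sets_restrict_space by (subst Int_commute, rule imageI) simp
    have "emeasure ?L (J i) = emeasure lebesgue (J i)"
      by (rule emeasure_restrict_space) (auto simp: J_def)
    also have "\<dots> \<le> emeasure lebesgue {real i / real (Suc n) ..< real (Suc i) / real (Suc n)}"
      by (rule emeasure_mono) (auto simp: J_def)
    also have "\<dots> = ennreal (real (Suc i) / real (Suc n) - real i / real (Suc n))"
      by (simp add: divide_right_mono)
    also have "real (Suc i) / real (Suc n) - real i / real (Suc n) = inverse (real (Suc n))"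
      by (simp add: field_simps)
    finally show "emeasure ?L (J i) \<le> ennreal (inverse (real (Suc n)))" .
  qed
  define P where "P = (\<lambda>i. A \<inter> (f -` J i \<inter> space M))"
  have fJ: "f -` J i \<inter> space M \<in> sets M" for i using f(1) J(1) by (rule measurable_sets)
  then have P_sets [measurable]: "P i \<in> sets M" for i using A(1) by (auto simp: P_def)
  have P_le: "prob (P i) \<le> inverse (real (Suc n))" for i
  proof -
    have "emeasure M (P i) \<le> emeasure M (f -` J i \<inter> space M)"
      using fJ by (intro emeasure_mono) (auto simp: P_def)
    also have "\<dots> \<le> ennreal (inverse (real (Suc n)))" using f(2)[OF J(1)] J(2) by simp
    finally show ?thesis by (simp add: emeasure_eq_measure)
  qed
  have "A \<subseteq> (\<Union>i\<le>Suc n. P i)"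
  proof
    fix x assume x: "x \<in> A"
    then have sp: "x \<in> space M" using sets.sets_into_space[OF A(1)] by auto
    then have fx: "0 \<le> f x" "f x \<le> 1" using measurable_space[OF f(1) sp] by (auto simp: space_restrict_space)
    define i where "i = nat \<lfloor>f x * real (Suc n)\<rfloor>"
    have "real i = real_of_int \<lfloor>f x * real (Suc n)\<rfloor>" using fx by (simp add: i_def)
    then have i: "real i \<le> f x * real (Suc n)" "f x * real (Suc n) < real (Suc i)"
      using floor_correct[of "f x * real (Suc n)"] by linarith+
    have "f x * real (Suc n) \<le> 1 * real (Suc n)" by (rule mult_right_mono[OF fx(2)]) simp
    then have "real i \<le> 1 * real (Suc n)" by (rule order_trans[OF i(1)])
    then have "i \<le> Suc n" by simp
    moreover have "f x \<in> J i" using i fx by (simp add: J_def divide_le_eq less_divide_eq)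
    ultimately show "x \<in> (\<Union>i\<le>Suc n. P i)" using x sp by (auto simp: P_def)
  qed
  then have "prob A \<le> prob (\<Union>i\<le>Suc n. P i)" by (intro finite_measure_mono) auto
  also have "\<dots> \<le> (\<Sum>i\<le>Suc n. prob (P i))" by (rule finite_measure_subadditive_finite) auto
  finally have "(\<Sum>i\<le>Suc n. prob (P i)) \<noteq> 0" using A(2) by linarith
  then obtain i where "prob (P i) \<noteq> 0" by (meson sum.neutral)
  then have "0 < prob (P i)" by (simp add: less_le)
  moreover have "prob (P i) < prob A" using P_le[of i] n by simp
  ultimately show ?thesis by (intro bexI[of _ "P i"] conjI) (simp_all add: P_sets, simp add: P_def)
qed

lemma rank_one_dataD:
  assumes "rank_one_data M T r s B Bs C"
  shows rank_one_cutting: "\<forall>n. 1 < r n"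
    and rank_one_partition: "\<forall>n. disjoint_family_on (Bs n) {0<..r n} \<and> (\<Union>i\<in>{0<..r n}. Bs n i) = B n"
    and rank_one_disjoint: "\<forall>n. disjoint_family_on (\<lambda>i. (T ^^ i) ` B n) {..<tower_height r s n}"
    and rank_one_first_spacer: "\<forall>n. \<forall>i\<in>{0<..r n}. s n i \<noteq> 0 \<longrightarrow> (T ^^ tower_height r s n) ` Bs n i = C n i 1"
    and rank_one_no_spacer: "\<forall>n. \<forall>i\<in>{0<..<r n}. s n i = 0 \<longrightarrow> (T ^^ tower_height r s n) ` Bs n i = Bs n (i + 1)"
    and rank_one_next_spacer: "\<forall>n. \<forall>i\<in>{0<..r n}. \<forall>j\<in>{0<..<s n i}. T ` C n i j = C n i (j + 1)"
    and rank_one_last_spacer: "\<forall>n. \<forall>i\<in>{0<..<r n}. s n i \<noteq> 0 \<longrightarrow> T ` C n i (s n i) = Bs n (i + 1)"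
    and rank_one_next_base: "\<forall>n. B (Suc n) = Bs n 1"
    and rank_one_levels: "(\<Union>n. tower_levels T r s B n) \<subseteq> sets M"
    and rank_one_dense: "\<forall>A\<in>sets M. \<forall>\<epsilon>::real. \<epsilon> > 0 \<longrightarrow>
      (\<exists>F. finite F \<and> F \<subseteq> (\<Union>n. tower_levels T r s B n) \<and> measure M ((A - \<Union>F) \<union> (\<Union>F - A)) < \<epsilon>)"
  using assms unfolding rank_one_data_def Let_def by - (elim conjE, assumption)+

lemma rank_one_next_cut:
  assumes data: "rank_one_data M T r s B Bs C" and i: "0 < i" "i < r n"
  shows "(T ^^ (tower_height r s n + s n i)) ` Bs n i = Bs n (Suc i)"
proof (cases "s n i = 0")
  case True
  then show ?thesis using rank_one_no_spacer[OF data] i by simp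
next
  case False
  have "(T ^^ j) ` C n i 1 = C n i (Suc j)" if "j < s n i" for j
    using that
  proof (induction j)
    case (Suc j)
    have "(T ^^ Suc j) ` C n i 1 = T ` ((T ^^ j) ` C n i 1)" by (simp add: image_comp)
    also have "\<dots> = T ` C n i (Suc j)" using Suc by simp
    also have "\<dots> = C n i (Suc j + 1)" using rank_one_next_spacer[OF data] i Suc.prems by simp
    finally show ?case by simp
  qed simp
  from this[of "s n i - 1"] False have *: "(T ^^ (s n i - 1)) ` C n i 1 = C n i (s n i)" by simp
  have "tower_height r s n + s n i = Suc ((s n i - 1) + tower_height r s n)" using False by simp
  then have "(T ^^ (tower_height r s n + s n i)) ` Bs n i =
      T ` ((T ^^ (s n i - 1)) ` ((T ^^ tower_height r s n) ` Bs n i))"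
    by (simp only: funpow.simps funpow_add image_comp comp_assoc)
  also have "(T ^^ tower_height r s n) ` Bs n i = C n i 1"
    using rank_one_first_spacer[OF data] i False by simp
  also have "T ` ((T ^^ (s n i - 1)) ` C n i 1) = Bs n (Suc i)"
    using rank_one_last_spacer[OF data] i False unfolding * by simp
  finally show ?thesis .
qed

text \<open>Going up from \<open>B (Suc n)\<close>, the piece \<open>Bs n (Suc i)\<close> is reached after \<open>i\<close> passages through the stage-\<open>n\<close>
  tower and the spacers above the first \<open>i\<close> pieces.\<close>

lemma rank_one_cuts:
  assumes data: "rank_one_data M T r s B Bs C" and i: "i < r n"
  shows "Bs n (Suc i) = (T ^^ (i * tower_height r s n + (\<Sum>j\<in>{0<..i}. s n j))) ` B (Suc n)"
  using i
proof (induction i)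
  case 0
  then show ?case using rank_one_next_base[OF data] by simp
next
  case (Suc i)
  let ?h = "tower_height r s n"
  let ?o = "i * ?h + (\<Sum>j\<in>{0<..i}. s n j)"
  have "{0<..Suc i} = insert (Suc i) {0<..i}" by auto
  then have "Suc i * ?h + (\<Sum>j\<in>{0<..Suc i}. s n j) = (?h + s n (Suc i)) + ?o" by simp
  moreover have "Bs n (Suc (Suc i)) = (T ^^ (?h + s n (Suc i))) ` ((T ^^ ?o) ` B (Suc n))"
    using rank_one_next_cut[OF data, of "Suc i" n] Suc by simp
  ultimately show ?case by (simp only: funpow_add image_comp)
qed

lemma rank_one_tower_system:
  assumes std: "nonatomic_standard_Lebesgue_space M" and T: "mp_transformation M T"
    and data: "rank_one_data M T r s B Bs C"
  shows "tower_system M T (tower_height r s) B"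
proof -
  let ?h = "tower_height r s"
  interpret prob_space M using std by (simp only: nonatomic_standard_Lebesgue_space_def)
  have r: "1 < r n" for n using rank_one_cutting[OF data] by blast
  show ?thesis
  proof unfold_locales
    show "measure_preserving_map M M T"
      using T by (simp only: mp_transformation_def mp_isomorphism_def)
    show "0 < ?h n" for n
    proof (induction n)
      case (Suc n)
      then show ?case using r[of n] by simp
    qed simp
    show "(T ^^ i) ` B n \<in> sets M" if "i < ?h n" for i n
      using rank_one_levels[OF data] that unfolding tower_levels_def by blast
    show "disjoint_family_on (\<lambda>i. (T ^^ i) ` B n) {..<?h n}" for n
      using rank_one_disjoint[OF data] by blast
    show "\<exists>R. 0 \<in> R \<and> B n = (\<Union>a\<in>R. (T ^^ a) ` B (Suc n)) \<and> (\<forall>a\<in>R. a + ?h n \<le> ?h (Suc n))" for n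
    proof -
      define ofs where "ofs = (\<lambda>i. i * ?h n + (\<Sum>j\<in>{0<..i}. s n j))"
      have "B n = (\<Union>i\<in>{0<..r n}. Bs n i)" using rank_one_partition[OF data] by blast
      also have "{0<..r n} = Suc ` {..<r n}"
        by (auto simp: image_iff less_Suc_eq_le gr0_conv_Suc Suc_le_eq)
      also have "(\<Union>i\<in>Suc ` {..<r n}. Bs n i) = (\<Union>i<r n. (T ^^ ofs i) ` B (Suc n))"
        using rank_one_cuts[OF data, of _ n] by (simp add: ofs_def)
      finally have "B n = (\<Union>a\<in>ofs ` {..<r n}. (T ^^ a) ` B (Suc n))" by simp
      moreover have "0 \<in> ofs ` {..<r n}"
        using r[of n] by (intro image_eqI[of _ _ 0]) (auto simp: ofs_def)
      moreover have "ofs i + ?h n \<le> ?h (Suc n)" if "i < r n" for i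
      proof -
        have "i * ?h n + ?h n = Suc i * ?h n" by simp
        also have "\<dots> \<le> r n * ?h n" using that by (intro mult_right_mono) auto
        finally have "i * ?h n + ?h n \<le> r n * ?h n" .
        moreover have "(\<Sum>j\<in>{0<..i}. s n j) \<le> (\<Sum>j\<in>{0<..r n}. s n j)"
          using that by (intro sum_mono2) auto
        ultimately show ?thesis by (simp add: ofs_def)
      qed
      ultimately show ?thesis by (intro exI[of _ "ofs ` {..<r n}"]) auto
    qed
    show "\<exists>F. finite F \<and> F \<subseteq> (\<Union>n. (\<lambda>i. (T ^^ i) ` B n) ` {..<?h n}) \<and>
        measure M ((A - \<Union>F) \<union> (\<Union>F - A)) < e" if "A \<in> sets M" "0 < (e::real)" for A e
      using rank_one_dense[OF data] that unfolding tower_levels_def by blast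
    show "\<exists>A'\<in>sets M. A' \<subseteq> A \<and> 0 < measure M A' \<and> measure M A' < measure M A"
      if "A \<in> sets M" "0 < measure M A" for A
      using nonatomic_of_standard[OF std that] .
  qed
qed

section \<open>The equivalence\<close>

theorem theorem4p1:
  fixes M :: "'a measure" and T :: "'a \<Rightarrow> 'a"
    and r :: "nat \<Rightarrow> nat" and s :: "nat \<Rightarrow> nat \<Rightarrow> nat"
    and B :: "nat \<Rightarrow> 'a set" and Bs :: "nat \<Rightarrow> nat \<Rightarrow> 'a set"
    and C :: "nat \<Rightarrow> nat \<Rightarrow> nat \<Rightarrow> 'a set"
    and k :: "nat \<Rightarrow> nat"
  assumes "nonatomic_standard_Lebesgue_space M"
    and "mp_transformation M T"
    and "rank_one_data M T r s B Bs C"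
    and "odometer_sequence k"
  shows "factors_onto M T (odometer_space k) (odometer_map k) \<longleftrightarrow>
    (\<forall>d\<in>odometer_factors k. \<forall>\<eta>::real. \<eta> > 0 \<longrightarrow>
      (\<exists>N. \<forall>m n. N \<le> m \<longrightarrow> m \<le> n \<longrightarrow>
        (\<exists>j\<in>{0..<d}.
          real (card {i \<in> level_indices T r s B m n. i mod d \<noteq> j})
            / real (card (level_indices T r s B m n)) < \<eta>)))"
proof -
  interpret tower_system M T "tower_height r s" B
    by (rule rank_one_tower_system[OF assms(1,2,3)])
  have ind_eq: "level_indices T r s B m n = ind m n" for m n
    by (simp add: level_indices_def ind_def lev_def)
  have compl: "complete_measure M"
    using assms(1) by (simp only: nonatomic_standard_Lebesgue_space_def)
  have factors: "k q \<in> odometer_factors k" for q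
    using odometer_sequence_pos[OF assms(4), of q] by (auto simp: odometer_factors_def Suc_le_eq intro!: exI[of _ q])
  show ?thesis
    unfolding ind_eq
  proof (intro iffI ballI allI impI)
    fix d and \<eta> :: real
    assume fac: "factors_onto M T (odometer_space k) (odometer_map k)"
      and "d \<in> odometer_factors k" and \<eta>: "\<eta> > 0"
    then obtain q where "d dvd k q" by (auto simp: odometer_factors_def)
    then show "\<exists>N. \<forall>m n. N \<le> m \<longrightarrow> m \<le> n \<longrightarrow> (\<exists>j\<in>{0..<d}.
        real (card {i \<in> ind m n. i mod d \<noteq> j}) / real (card (ind m n)) < \<eta>)"
      using concentration_of_odometer_factor[OF assms(4) _ fac \<eta>] by blast
  next
    assume conc: "\<forall>d\<in>odometer_factors k. \<forall>\<eta>::real. \<eta> > 0 \<longrightarrow>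
      (\<exists>N. \<forall>m n. N \<le> m \<longrightarrow> m \<le> n \<longrightarrow> (\<exists>j\<in>{0..<d}.
        real (card {i \<in> ind m n. i mod d \<noteq> j}) / real (card (ind m n)) < \<eta>))"
    show "factors_onto M T (odometer_space k) (odometer_map k)"
      by (rule odometer_factor_of_concentration[OF compl assms(4)]) (use conc factors in blast)
  qed
qed

end
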